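(* Let $0<\kappa<1$, $S>0$ and $\eta>0$ be chosen independently of $\nu$. For $\nu>0$ let $\Xi=\Xi_\nu$ be the interface parameter and $U=U_\nu$ the profile of the relevant traveling wave with parameters $(\nu,\kappa,S,\eta)$. Then $$\Xi=\frac{\nu^2S\kappa}{2(1-\kappa)}\,\ln\left(\frac{2(1-\kappa)^2}{\nu^2S\eta}\right)\bigl(1+O(\nu^2)\bigr)\qquad\text{as }\nu\to0,$$ so in particular $\Xi\to0$ as $\nu\to0$, and the profiles converge pointwise for $X\neq0$ according to $$U(X)\;\xrightarrow{\;\nu\to0\;}\;\begin{cases}-\kappa-\eta\,S^{-1}\bigl(1-\exp(SX)\bigr)&\text{for }X<0,\\[2pt] 2-\kappa+(\eta+2S)\,S^{-1}\bigl(\exp(SX)-1\bigr)&\text{for }X>0.\end{cases}$$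
   Context: Background: one considers increasing traveling waves $u(t,x)=U(x+St)$, $S>0$, of $\partial_t u-\nu^2\partial_x^2\partial_t u=\partial_x^2\Phi'(u)$, where $\Phi'(u)=u+1$ for $u\le-\kappa$, $\Phi'(u)=-\frac{1-\kappa}{\kappa}u$ for $-\kappa\le u\le\kappa$, $\Phi'(u)=u-1$ for $u\ge\kappa$. Exponential rates: $$\lambda_\pm=-\frac{1}{2\nu^2S}\pm\sqrt{\Bigl(\frac{1}{2\nu^2S}\Bigr)^2+\frac1{\nu^2}},\qquad \mu_\pm=\frac{1-\kappa}{2\nu^2S\kappa}\pm\sqrt{\Bigl(\frac{1-\kappa}{2\nu^2S\kappa}\Bigr)^2+\frac1{\nu^2}}.$$ Traveling wave problem (with parameters $\nu,\kappa,S,\Xi$, where $\Xi>0$): set $I_-=(-\infty,-\Xi]$, $I_0=[-\Xi,\Xi]$, $I_+=[\Xi,\infty)$. A solution is a continuous function $V:\mathbb{R}\to\mathbb{R}$ that satisfies $$S\,V-\nu^2S\,V''=\bigl(V-c\,V\bigr)'$$ in the weak (distributional) sense on $\mathbb{R}$, where $c(X)=1/\kappa$ for $X\in I_0$ and $c(X)=0$ otherwise, and that satisfies the constraints $V(X)\ge0$ for all $X\in\mathbb{R}$ and $\int_{-\Xi}^{\Xi}V(X)\,dX=2\kappa$. Equivalently to the weak equation, $V$ is continuous, has the form $$V(X)=\begin{cases}A_-e^{\lambda_-X}+A_+e^{\lambda_+X}&X\in I_-,\\ B_-e^{\mu_-X}+B_+e^{\mu_+X}&X\in I_0,\\ C_-e^{\lambda_-X}+C_+e^{\lambda_+X}&X\in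 I_+,\end{cases}$$ with real coefficients, and the one-sided derivatives satisfy $V'(-\Xi-0)=V'(-\Xi+0)-\frac{1}{\nu^2S\kappa}V(-\Xi)$ and $V'(\Xi+0)=V'(\Xi-0)-\frac{1}{\nu^2S\kappa}V(\Xi)$. Relevant traveling wave with parameters $(\nu,\kappa,S,\eta)$, $\eta>0$: there exist a unique $\Xi>0$ and a unique solution $V$ of the traveling wave problem with parameters $\nu,\kappa,S,\Xi$ such that $V(X)=\eta\exp(\lambda_+(X+\Xi))$ for all $X\le-\Xi$ (it satisfies $A_-=0<A_+$, $B_-<0<B_+$, $C_\pm>0$). This $\Xi$ is the interface parameter of the wave, and the profile $U$ is the primitive of $V$ (so $U'=V$) normalized by $U(-\Xi)=-\kappa$; it then also satisfies $U(\Xi)=\kappa$. The implied constants in $O(\cdot)$ may depend on $\kappa,S,\eta$ but not on $\nu$. *)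

theory Defs
  imports "HOL-Analysis.Analysis" "HOL-Library.Landau_Symbols"
begin

definition lambda_plus :: "real \<Rightarrow> real \<Rightarrow> real" where
  "lambda_plus \<nu> S = - 1 / (2 * \<nu>\<^sup>2 * S) + sqrt ((1 / (2 * \<nu>\<^sup>2 * S))\<^sup>2 + 1 / \<nu>\<^sup>2)"

text \<open>The coefficient $c$: the indicator function of $[-\Xi, \Xi]$, scaled by $1/\kappa$.\<close>

definition spinodal_coeff :: "real \<Rightarrow> real \<Rightarrow> real \<Rightarrow> real" where
  "spinodal_coeff \<kappa> \<Xi> X = (if X \<in> {-\<Xi>..\<Xi>} then 1 / \<kappa> else 0)"

text \<open>Test functions: all iterated derivatives exist everywhere, and the support is compact.\<close>

definition test_function :: "(real \<Rightarrow> real) \<Rightarrow> bool" where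
  "test_function \<phi> \<longleftrightarrow>
     (\<forall>n x. (deriv ^^ n) \<phi> field_differentiable (at x)) \<and> compact (closure {x. \<phi> x \<noteq> 0})"

text \<open>
  The distributional form of $S V - \nu^2 S V'' = (V - c V)'$ on the whole line.
  All derivatives are moved to the test function, with a sign for each of them.
  For continuous $V$ all integrands are bounded, piecewise continuous and compactly
  supported, so every integral below exists.
\<close>

definition weak_wave_equation ::
    "real \<Rightarrow> real \<Rightarrow> real \<Rightarrow> real \<Rightarrow> (real \<Rightarrow> real) \<Rightarrow> bool" where
  "weak_wave_equation \<nu> \<kappa> S \<Xi> V \<longleftrightarrow>
     (\<forall>\<phi>. test_function \<phi> \<longrightarrow>
        integral UNIV (\<lambda>X. S * V X * \<phi> X) - \<nu>\<^sup>2 * S * integral UNIV (\<lambda>X. V X * deriv (deriv \<phi>) X)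
        = - integral UNIV (\<lambda>X. (V X - spinodal_coeff \<kappa> \<Xi> X * V X) * deriv \<phi> X))"

definition traveling_wave_solution ::
    "real \<Rightarrow> real \<Rightarrow> real \<Rightarrow> real \<Rightarrow> (real \<Rightarrow> real) \<Rightarrow> bool" where
  "traveling_wave_solution \<nu> \<kappa> S \<Xi> V \<longleftrightarrow>
     continuous_on UNIV V \<and> weak_wave_equation \<nu> \<kappa> S \<Xi> V \<and>
     (\<forall>X. V X \<ge> 0) \<and> integral {-\<Xi>..\<Xi>} V = 2 * \<kappa>"

definition relevant_traveling_wave ::
    "real \<Rightarrow> real \<Rightarrow> real \<Rightarrow> real \<Rightarrow> real \<Rightarrow> (real \<Rightarrow> real) \<Rightarrow> bool" where
  "relevant_traveling_wave \<nu> \<kappa> S \<eta> \<Xi> V \<longleftrightarrow>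
     \<Xi> > 0 \<and> traveling_wave_solution \<nu> \<kappa> S \<Xi> V \<and>
     (\<forall>X \<le> -\<Xi>. V X = \<eta> * exp (lambda_plus \<nu> S * (X + \<Xi>)))"

definition wave_profile :: "real \<Rightarrow> real \<Rightarrow> (real \<Rightarrow> real) \<Rightarrow> (real \<Rightarrow> real) \<Rightarrow> bool" where
  "wave_profile \<kappa> \<Xi> V U \<longleftrightarrow>
     (\<forall>X. (U has_real_derivative V X) (at X)) \<and> U (-\<Xi>) = -\<kappa>"

end

theory Submission
  imports Defs "HOL-Computational_Algebra.Polynomial" "HOL-Real_Asymp.Real_Asymp"
begin

text \<open>
  The weak equation is reduced to ordinary differential equations with constant coefficients, which
  are solved explicitly; the asymptotics is then read off from one transcendental equation for $\Xi$.

  In terms of primitives the weak equation says that a certain continuous function has a vanishing second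
  distributional derivative. Such a function is affine (\<open>affine_if_weak_second_derivative_0\<close>), so $V$ is
  differentiable away from $\pm\Xi$ (\<open>weak_wave_equation_imp_ode\<close>). The prescribed behavior on the left
  fixes the integration constant, and with $Z=U+\kappa+\eta/\lambda_+$ the equation becomes the linear
  system $Z'=V$, $\nu^2SV'=SZ-V+cV$. Its exponents are $\mu_\pm$ in $[-\Xi,\Xi]$ and $\lambda_\pm$ outside.
  Transporting both eigenmodes from $-\Xi$ to $\Xi$ and inserting the constraint $U(\Xi)=\kappa$ gives
  \[ (\mu_+-\mu_-)\Bigl(2\kappa+\frac{\eta}{\lambda_+}\Bigr)
     = \eta\Bigl(1-\frac{\mu_-}{\lambda_+}\Bigr)e^{2\mu_+\Xi} + \eta\Bigl(\frac{\mu_+}{\lambda_+}-1\Bigr)e^{2\mu_-\Xi} \]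
  and a closed formula for $U$ on the right (\<open>relevant_wave_explicit\<close>).

  As $\nu\to0$, $\lambda_+$ and $\mu_-$ converge to $S$ and $-S\kappa/(1-\kappa)$, while $\mu_+$ and $-\lambda_-$ grow
  like $(1-\kappa)/(\kappa\nu^2S)$ and $1/(\nu^2S)$. If $\Xi$ is small, the last exponential is close to $1$ and
  the terms $\eta\mu_+/\lambda_+$ cancel, leaving $\eta e^{2\mu_+\Xi}\approx2\kappa\mu_+(1-\kappa)$, whose logarithm is
  the claimed formula (\<open>interface_width_asymptotics\<close>).

  The profile formulas then converge termwise. On the right, $V(\Xi)$ is of order $\nu^{-2}$, and the mode
  with exponent $\lambda_-$ decays in a layer of width of order $\nu^2$. Across this layer $U$ jumps from
  $\kappa$ to $2-\kappa$, which explains the constant term of the limit profile for $X>0$.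
\<close>

section \<open>Compactly supported smooth functions\<close>

text \<open>
  Closure under products and affine substitutions is a plain induction on the order for this
  recursive form. For iterated \<^const>\<open>deriv\<close> it would need the Leibniz rule.
\<close>

primrec times_differentiable :: "nat \<Rightarrow> (real \<Rightarrow> real) \<Rightarrow> bool" where
  "times_differentiable 0 f \<longleftrightarrow> True"
| "times_differentiable (Suc n) f \<longleftrightarrow>
     (\<exists>f'. (\<forall>x. (f has_real_derivative f' x) (at x)) \<and> times_differentiable n f')"

lemma times_differentiable_Suc_imp: "times_differentiable (Suc n) f \<Longrightarrow> times_differentiable n f"
  by (induction n arbitrary: f) (simp, metis times_differentiable.simps(2))

lemma times_differentiable_const: "times_differentiable n (\<lambda>_. c)"
proof (induction n arbitrary: c)
  case (Suc n)
  show ?case unfolding times_differentiable.simps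
    by (rule exI[of _ "\<lambda>_. 0"]) (use Suc in auto)
qed simp

lemma times_differentiable_add:
  "times_differentiable n f \<Longrightarrow> times_differentiable n g \<Longrightarrow> times_differentiable n (\<lambda>x. f x + g x)"
proof (induction n arbitrary: f g)
  case (Suc n)
  then obtain f' g' where "\<forall>x. (f has_real_derivative f' x) (at x)" "times_differentiable n f'"
    "\<forall>x. (g has_real_derivative g' x) (at x)" "times_differentiable n g'"
    by auto
  with Suc.IH[of f' g'] show ?case
    by (auto intro!: exI[of _ "\<lambda>x. f' x + g' x"] DERIV_add)
qed simp

lemma times_differentiable_mult:
  "times_differentiable n f \<Longrightarrow> times_differentiable n g \<Longrightarrow> times_differentiable n (\<lambda>x. f x * g x)"
proof (induction n arbitrary: f g)
  case (Suc n)
  then obtain f' g' where fg: "\<forall>x. (f has_real_derivative f' x) (at x)" "times_differentiable n f'"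
    "\<forall>x. (g has_real_derivative g' x) (at x)" "times_differentiable n g'"
    by auto
  have "times_differentiable n (\<lambda>x. f' x * g x + f x * g' x)"
    using Suc fg times_differentiable_Suc_imp by (intro times_differentiable_add) auto
  moreover have "\<forall>x. ((\<lambda>x. f x * g x) has_real_derivative f' x * g x + f x * g' x) (at x)"
    using fg by (auto intro!: derivative_eq_intros)
  ultimately show ?case by auto
qed simp

lemma times_differentiable_affine:
  "times_differentiable n f \<Longrightarrow> times_differentiable n (\<lambda>x. f (a * x + b))"
proof (induction n arbitrary: f)
  case (Suc n)
  then obtain f' where f: "\<forall>x. (f has_real_derivative f' x) (at x)" "times_differentiable n f'"
    by auto
  have "times_differentiable n (\<lambda>x. f' (a * x + b) * a)"
    using Suc f by (intro times_differentiable_mult times_differentiable_const) auto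
  moreover have "((\<lambda>x. f (a * x + b)) has_real_derivative f' (a * x + b) * a) (at x)" for x
    by (rule DERIV_chain2[of f]) (use f in \<open>auto intro!: derivative_eq_intros\<close>)
  ultimately show ?case unfolding times_differentiable.simps by (intro exI[of _ "\<lambda>x. f' (a * x + b) * a"]) blast
qed simp

lemma times_differentiable_funpow_deriv:
  "times_differentiable (Suc n) f \<Longrightarrow> (deriv ^^ n) f field_differentiable (at x)"
proof (induction n arbitrary: f)
  case 0
  then show ?case by (auto simp: field_differentiable_def)
next
  case (Suc n)
  then obtain f' where f: "\<And>x. (f has_real_derivative f' x) (at x)" "times_differentiable (Suc n) f'"
    unfolding times_differentiable.simps(2)[of "Suc n"] by blast
  have "deriv f = f'"
    using f(1) by (intro ext DERIV_imp_deriv)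
  with Suc.IH[OF f(2)] show ?case
    by (simp add: funpow_Suc_right del: funpow.simps)
qed

text \<open>
  For $p=1$ this is the classical function that is flat at $0$. The polynomial factor in
  $1/x$ is there because this family is closed under differentiation: differentiating $p(1/x)e^{-1/x}$
  replaces $p$ by $t^2(p-p')$.
\<close>

definition flat :: "real poly \<Rightarrow> real \<Rightarrow> real" where
  "flat p x = (if x > 0 then poly p (1 / x) * exp (- 1 / x) else 0)"

lemma poly_times_exp_minus_tendsto_0: "((\<lambda>t. poly p t * exp (- t)) \<longlongrightarrow> (0::real)) at_top"
proof -
  have "((\<lambda>t. \<Sum>i\<le>degree p. coeff p i * (t ^ i / exp t)) \<longlongrightarrow> (\<Sum>i\<le>degree p. coeff p i * 0)) at_top"
    by (intro tendsto_sum tendsto_mult tendsto_const tendsto_power_div_exp_0)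
  then show ?thesis
    by (simp add: poly_altdef sum_distrib_right exp_minus divide_inverse mult.assoc)
qed

lemma flat_has_derivative:
  "(flat p has_real_derivative flat (monom 1 2 * (p - pderiv p)) x) (at x)"
proof -
  consider "x > 0" | "x < 0" | "x = 0" by linarith
  then show ?thesis
  proof cases
    case 1
    have "((\<lambda>x. poly p (1 / x) * exp (- 1 / x)) has_real_derivative
        flat (monom 1 2 * (p - pderiv p)) x) (at x)"
      using 1 by (auto intro!: derivative_eq_intros
          simp: flat_def poly_monom field_simps power2_eq_square)
    then show ?thesis
      by (rule DERIV_cong_ev[THEN iffD1, rotated -1])
        (use 1 in \<open>auto simp: flat_def intro!: eventually_mono[OF eventually_nhds_in_open[of "{0<..}" x]]\<close>)
  next
    case 2
    have "((\<lambda>x. 0) has_real_derivative flat (monom 1 2 * (p - pderiv p)) x) (at x)"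
      using 2 by (auto simp: flat_def)
    then show ?thesis
      by (rule DERIV_cong_ev[THEN iffD1, rotated -1])
        (use 2 in \<open>auto simp: flat_def intro!: eventually_mono[OF eventually_nhds_in_open[of "{..<0}" x]]\<close>)
  next
    case 3
    have "((\<lambda>h. poly (pCons 0 p) (inverse h) * exp (- inverse h)) \<longlongrightarrow> 0) (at_right 0)"
      by (rule filterlim_compose[OF poly_times_exp_minus_tendsto_0 filterlim_inverse_at_top_right])
    then have "((\<lambda>h. flat p h / h) \<longlongrightarrow> 0) (at_right 0)"
      by (rule Lim_transform_eventually)
        (auto simp: flat_def eventually_at_right_less field_simps intro!: eventually_at_rightI[of 0 1])
    moreover have "((\<lambda>h. flat p h / h) \<longlongrightarrow> 0) (at_left 0)"
      by (rule Lim_transform_eventually[OF tendsto_const])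
        (auto simp: flat_def intro!: eventually_at_leftI[of "-1"])
    ultimately have "((\<lambda>h. flat p h / h) \<longlongrightarrow> 0) (at 0)"
      by (simp add: filterlim_split_at)
    then show ?thesis
      using 3 by (simp add: has_field_derivative_iff flat_def)
  qed
qed

lemma times_differentiable_flat: "times_differentiable n (flat p)"
  by (induction n arbitrary: p) (use flat_has_derivative in \<open>auto\<close>)

lemma continuous_has_primitive:
  fixes f :: "real \<Rightarrow> real"
  assumes "continuous_on UNIV f"
  obtains F where "\<And>x. (F has_real_derivative f x) (at x)" "F 0 = 0"
proof -
  define F where "F x = integral {0..x} f - integral {x..0} f" for x
  have cont: "continuous_on A f" for A
    using assms continuous_on_subset by blast
  have F: "F x = integral {-N..x} f - integral {-N..0} f" if "x \<in> {-N..N}" for x N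
  proof (cases "x \<ge> 0")
    case True
    then show ?thesis
      using that Henstock_Kurzweil_Integration.integral_combine[of "-N" 0 x f] integrable_continuous_real[OF cont]
      by (cases "x = 0") (auto simp: F_def)
  next
    case False
    then show ?thesis
      using that Henstock_Kurzweil_Integration.integral_combine[of "-N" x 0 f] integrable_continuous_real[OF cont]
      by (auto simp: F_def)
  qed
  have "(F has_real_derivative f x) (at x)" for x
  proof -
    define N where "N = \<bar>x\<bar> + 1"
    have x: "x \<in> {-N<..<N}"
      by (auto simp: N_def)
    have "((\<lambda>x. integral {-N..x} f) has_real_derivative f x) (at x within {-N..N})"
      using integral_has_real_derivative[OF cont] x by auto
    then have "((\<lambda>x. integral {-N..x} f) has_real_derivative f x) (at x)"
      using x by (simp add: at_within_Icc_at)
    then have "((\<lambda>x. integral {-N..x} f - integral {-N..0} f) has_real_derivative f x) (at x)"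
      by (auto intro!: derivative_eq_intros)
    then show ?thesis
      by (rule DERIV_cong_ev[THEN iffD1, rotated -1])
        (use x in \<open>auto simp: F[of _ N] intro!: eventually_mono[OF eventually_nhds_in_open[of "{-N<..<N}" x]]\<close>)
  qed
  moreover have "F 0 = 0" by (simp add: F_def)
  ultimately show ?thesis using that by blast
qed

text \<open>
  The second primitive $R$ of a bump is not itself compactly supported, but to the right of the bump
  it is affine. A combination of translates of $R$ whose coefficients annihilate all affine functions
  is therefore a test function, and its second derivative is the same combination of translates of
  the bump.
\<close>

lemma bump_double_primitive:
  fixes h :: real
  assumes "h > 0"
  obtains \<rho> R' R m k where
    "continuous_on UNIV \<rho>" "\<And>t. \<rho> t \<ge> 0" "\<And>t. \<rho> t \<noteq> 0 \<longleftrightarrow> 0 < t \<and> t < h"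
    "\<And>t. (R has_real_derivative R' t) (at t)" "\<And>t. (R' has_real_derivative \<rho> t) (at t)"
    "\<And>n. times_differentiable n R" "\<And>t. t \<le> 0 \<Longrightarrow> R t = 0" "\<And>t. t \<ge> h \<Longrightarrow> R t = m * t + k"
proof -
  define \<rho> where "\<rho> t = flat 1 t * flat 1 (h - t)" for t
  have smooth: "times_differentiable n \<rho>" for n
    using times_differentiable_mult[OF times_differentiable_flat
        times_differentiable_affine[OF times_differentiable_flat, of n 1 "-1" h], of 1]
    by (simp add: \<rho>_def[abs_def])
  have cont: "continuous_on UNIV \<rho>"
    using smooth[of 1] by (auto intro: DERIV_continuous_on has_field_derivative_at_within)
  have nz: "\<rho> t \<noteq> 0 \<longleftrightarrow> 0 < t \<and> t < h" for t
    by (auto simp: \<rho>_def flat_def)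
  have zero: "\<rho> t = 0" if "t \<le> 0 \<or> h \<le> t" for t
    using nz[of t] that by linarith
  obtain R' where R': "\<And>t. (R' has_real_derivative \<rho> t) (at t)" "R' 0 = 0"
    using continuous_has_primitive[OF cont] by metis
  have "continuous_on UNIV R'"
    using R'(1) by (auto intro: DERIV_continuous_on has_field_derivative_at_within)
  then obtain R where R: "\<And>t. (R has_real_derivative R' t) (at t)" "R 0 = 0"
    using continuous_has_primitive by blast
  have R'_left: "R' t = 0" if "t \<le> 0" for t
  proof -
    have "\<exists>c. \<forall>x\<in>{..0}. R' x = c"
      by (rule has_field_derivative_zero_constant)
        (use R'(1) zero in \<open>auto intro: has_field_derivative_at_within simp: convex_real_interval\<close>, metis has_field_derivative_at_within)
    then show ?thesis using R'(2) that by force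
  qed
  have R_left: "R t = 0" if "t \<le> 0" for t
  proof -
    have "\<exists>c. \<forall>x\<in>{..0}. R x = c"
      by (rule has_field_derivative_zero_constant)
        (use R(1) R'_left in \<open>auto simp: convex_real_interval\<close>, metis has_field_derivative_at_within)
    then show ?thesis using R(2) that by force
  qed
  obtain m where m: "\<And>t. t \<ge> h \<Longrightarrow> R' t = m"
  proof -
    have "\<exists>c. \<forall>x\<in>{h..}. R' x = c"
      by (rule has_field_derivative_zero_constant)
        (use R'(1) zero in \<open>auto simp: convex_real_interval\<close>, metis has_field_derivative_at_within)
    then show ?thesis using that by auto
  qed
  obtain k where k: "\<And>t. t \<ge> h \<Longrightarrow> R t = m * t + k"
  proof -
    have "\<exists>c. \<forall>x\<in>{h..}. R x - m * x = c"
    proof (rule has_field_derivative_zero_constant)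
      fix x assume "x \<in> {h..}"
      then show "((\<lambda>x. R x - m * x) has_real_derivative 0) (at x within {h..})"
        using m has_field_derivative_at_within[OF R(1)] by (auto intro!: derivative_eq_intros)
    qed (auto simp: convex_real_interval)
    then obtain c where "\<And>x. x \<ge> h \<Longrightarrow> R x - m * x = c" by auto
    then show ?thesis by (intro that[of c]) (simp add: algebra_simps)
  qed
  have "times_differentiable n R" for n
  proof -
    have "times_differentiable (Suc (Suc n)) R"
      unfolding times_differentiable.simps(2) using R(1) R'(1) smooth by blast
    then show ?thesis using times_differentiable_Suc_imp by blast
  qed
  then show ?thesis
    by (intro that[of \<rho> R R' m k])
      (use cont nz R R' R_left k in \<open>auto simp: \<rho>_def flat_def\<close>)
qed

section \<open>From the weak equation to an ordinary differential equation\<close>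

lemma has_integral_UNIV_of_support:
  fixes f :: "real \<Rightarrow> real"
  assumes "continuous_on UNIV f" "\<And>x. x \<notin> {a..b} \<Longrightarrow> f x = 0"
  shows "(f has_integral integral {a..b} f) UNIV"
  by (rule has_integral_on_superset[of f _ "{a..b}"])
    (use assms in \<open>auto intro!: integrable_integral integrable_continuous_real intro: continuous_on_subset\<close>)

text \<open>
  Test with $\psi(y) = R(y-x)+(x-1)R(y)-xR(y-1)$, where $R$ is the second primitive of a bump $\rho$
  supported in $[0,h]$. The coefficients $1, x-1, -x$ at the nodes $x, 0, 1$ annihilate affine functions,
  so $\psi$ has compact support. After translation, the hypothesis reads $\int K\rho=0$ with
  $K(t)=H(t+x)+(x-1)H(t)-xH(t+1)$. As $h$ may be so small that $K$ keeps the sign of $K(0)$ on $[0,h]$,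
  this forces $K(0)=0$, which is the claim.
\<close>

lemma affine_if_weak_second_derivative_0:
  fixes H :: "real \<Rightarrow> real"
  assumes cont: "continuous_on UNIV H"
    and weak: "\<And>\<phi>. test_function \<phi> \<Longrightarrow> integral UNIV (\<lambda>x. H x * deriv (deriv \<phi>) x) = 0"
  shows "H x = H 0 + x * (H 1 - H 0)"
proof (rule ccontr)
  assume neq: "H x \<noteq> H 0 + x * (H 1 - H 0)"
  define K where "K t = H (t + x) + (x - 1) * H t - x * H (t + 1)" for t
  have contK: "continuous_on UNIV K"
    unfolding K_def[abs_def]
    by (intro continuous_intros continuous_on_compose2[OF cont]) auto
  have K0: "K 0 \<noteq> 0"
    using neq by (simp add: K_def algebra_simps)
  obtain h where h: "h > 0" "\<And>t. \<bar>t\<bar> < h \<Longrightarrow> K t * K 0 > 0"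
  proof -
    have "isCont (\<lambda>t. K t * K 0) 0"
      using contK by (intro continuous_intros) (auto simp: continuous_on_eq_continuous_at)
    then have "((\<lambda>t. K t * K 0) \<longlongrightarrow> K 0 * K 0) (at 0)"
      by (simp add: isCont_def)
    then have "\<forall>\<^sub>F t in at 0. K t * K 0 > 0"
      by (rule order_tendstoD) (use K0 in \<open>auto simp: zero_less_mult_iff\<close>)
    then obtain h where "h > 0" "\<And>t. t \<noteq> 0 \<Longrightarrow> \<bar>t\<bar> < h \<Longrightarrow> K t * K 0 > 0"
      by (auto simp: eventually_at dist_real_def)
    moreover have "K 0 * K 0 > 0"
      using K0 by (auto simp: zero_less_mult_iff)
    ultimately show ?thesis using that by metis
  qed
  obtain \<rho> R' R m k where \<rho>: "continuous_on UNIV \<rho>" "\<And>t. \<rho> t \<ge> 0" "\<And>t. \<rho> t \<noteq> 0 \<longleftrightarrow> 0 < t \<and> t < h"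
    and R: "\<And>t. (R has_real_derivative R' t) (at t)" "\<And>t. (R' has_real_derivative \<rho> t) (at t)"
    "\<And>n. times_differentiable n R" "\<And>t. t \<le> 0 \<Longrightarrow> R t = 0" "\<And>t. t \<ge> h \<Longrightarrow> R t = m * t + k"
    using bump_double_primitive[OF h(1)] by metis
  define \<psi> where "\<psi> y = R (y - x) + (x - 1) * R y - x * R (y - 1)" for y
  have smooth: "times_differentiable n \<psi>" for n
  proof -
    have *: "times_differentiable n (\<lambda>y. c * R (y - a))" for c a
      using times_differentiable_mult[OF times_differentiable_const
          times_differentiable_affine[OF R(3), of n 1 "- a"]] by simp
    have "times_differentiable n (\<lambda>y. (1 * R (y - x) + (x - 1) * R (y - 0)) + (- x) * R (y - 1))"
      by (intro times_differentiable_add *)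
    then show ?thesis by (simp add: \<psi>_def[abs_def])
  qed
  (* All three translates of R vanish to the left of -B and are affine to the right of B. *)
  define B where "B = \<bar>x\<bar> + 1 + h"
  have support: "\<psi> y = 0" if "y \<notin> {-B..B}" for y
  proof (cases "y < -B")
    case True
    then show ?thesis using R(4) h(1) by (simp add: \<psi>_def B_def)
  next
    case False
    then have "y > B" using that by auto
    then show ?thesis using h(1) by (simp add: \<psi>_def B_def R(5)) (simp add: algebra_simps)
  qed
  have test: "test_function \<psi>"
    unfolding test_function_def
  proof
    show "\<forall>n x. (deriv ^^ n) \<psi> field_differentiable at x"
      using times_differentiable_funpow_deriv smooth by blast
    have "bounded {x. \<psi> x \<noteq> 0}"
      by (rule bounded_subset[of "{-B..B}"]) (use support in \<open>blast intro: bounded_closed_interval\<close>)+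
    then show "compact (closure {x. \<psi> x \<noteq> 0})"
      by (simp add: compact_closure)
  qed
  have "deriv \<psi> = (\<lambda>y. R' (y - x) + (x - 1) * R' y - x * R' (y - 1))"
    unfolding \<psi>_def[abs_def]
    by (intro ext DERIV_imp_deriv) (auto intro!: derivative_eq_intros DERIV_chain2[OF R(1)] R(1))
  then have \<psi>'': "deriv (deriv \<psi>) = (\<lambda>y. \<rho> (y - x) + (x - 1) * \<rho> y - x * \<rho> (y - 1))"
    by (auto intro!: ext DERIV_imp_deriv derivative_eq_intros DERIV_chain2[OF R(2)] R(2))
  have \<rho>0: "\<rho> t = 0" if "t \<notin> {0..h}" for t
    using \<rho>(3)[of t] that by auto
  have shift: "((\<lambda>y. H y * \<rho> (y - a)) has_integral integral {0..h} (\<lambda>t. H (t + a) * \<rho> t)) UNIV" for a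
  proof -
    have "((\<lambda>t. H (t + a) * \<rho> t) has_integral integral {0..h} (\<lambda>t. H (t + a) * \<rho> t)) {0..h}"
      by (intro integrable_integral integrable_continuous_real continuous_intros
          continuous_on_compose2[OF cont] continuous_on_subset[OF \<rho>(1)]) auto
    from has_integral_shift_real_ivl[OF this, of "- a"]
    have "((\<lambda>y. H y * \<rho> (y - a)) has_integral integral {0..h} (\<lambda>t. H (t + a) * \<rho> t)) {a..h + a}"
      by simp
    then show ?thesis
      by (rule has_integral_on_superset) (auto intro!: \<rho>0)
  qed
  have int: "(\<lambda>t. H (t + a) * \<rho> t) integrable_on {0..h}" for a
    by (intro integrable_continuous_real continuous_intros
          continuous_on_compose2[OF cont] continuous_on_subset[OF \<rho>(1)]) auto
  have "((\<lambda>y. H y * \<rho> (y - x) + (x - 1) * (H y * \<rho> (y - 0)) - x * (H y * \<rho> (y - 1))) has_integral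
      integral {0..h} (\<lambda>t. H (t + x) * \<rho> t) + (x - 1) * integral {0..h} (\<lambda>t. H (t + 0) * \<rho> t)
        - x * integral {0..h} (\<lambda>t. H (t + 1) * \<rho> t)) UNIV"
    by (intro has_integral_add has_integral_diff has_integral_mult_right shift)
  also have "integral {0..h} (\<lambda>t. H (t + x) * \<rho> t) + (x - 1) * integral {0..h} (\<lambda>t. H (t + 0) * \<rho> t)
        - x * integral {0..h} (\<lambda>t. H (t + 1) * \<rho> t) = 
      integral {0..h} (\<lambda>t. H (t + x) * \<rho> t + (x - 1) * (H (t + 0) * \<rho> t) - x * (H (t + 1) * \<rho> t))"
    by (rule integral_unique[symmetric], intro has_integral_add has_integral_diff
        has_integral_mult_right integrable_integral int)
  also have "\<dots> = integral {0..h} (\<lambda>t. K t * \<rho> t)"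
    by (intro arg_cong[of _ _ "integral _"] ext) (simp add: K_def algebra_simps)
  also have "(\<lambda>y. H y * \<rho> (y - x) + (x - 1) * (H y * \<rho> (y - 0)) - x * (H y * \<rho> (y - 1))) =
      (\<lambda>y. H y * deriv (deriv \<psi>) y)"
    by (auto simp: \<psi>'' algebra_simps)
  finally have "integral {0..h} (\<lambda>t. K t * \<rho> t) = 0"
    using weak[OF test] integral_unique by metis
  then have 0: "integral {0..h} (\<lambda>t. (K t * K 0) * \<rho> t) = 0"
    using integral_mult_right[of "{0..h}" "K 0" "\<lambda>t. K t * \<rho> t"] by (simp add: mult_ac)
  have nonneg: "K t * K 0 * \<rho> t \<ge> 0" if "t \<in> {0..h}" for t
    using h(2)[of t] \<rho>(2)[of t] \<rho>(3)[of t] that by (cases "\<rho> t = 0") (auto intro!: mult_nonneg_nonneg)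
  have "\<forall>t\<in>{0..h}. (K t * K 0) * \<rho> t = 0"
    using 0 h(1) nonneg
    by (subst (asm) integral_eq_0_iff)
      (auto intro!: continuous_intros continuous_on_subset[OF contK] continuous_on_subset[OF \<rho>(1)])
  then have "(K (h/2) * K 0) * \<rho> (h/2) = 0"
    using h(1) by auto
  then show False
    using h(2)[of "h/2"] \<rho>(3)[of "h/2"] h(1) by auto
qed

lemma test_functionE:
  assumes "test_function \<phi>"
  obtains M where "M > 0"
    "\<And>x. (\<phi> has_real_derivative deriv \<phi> x) (at x)"
    "\<And>x. (deriv \<phi> has_real_derivative deriv (deriv \<phi>) x) (at x)"
    "continuous_on UNIV (deriv (deriv \<phi>))"
    "\<And>x. \<bar>x\<bar> \<ge> M \<Longrightarrow> \<phi> x = 0" "\<And>x. \<bar>x\<bar> \<ge> M \<Longrightarrow> deriv \<phi> x = 0"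
    "\<And>x. \<bar>x\<bar> \<ge> M \<Longrightarrow> deriv (deriv \<phi>) x = 0"
proof -
  have diff: "(deriv ^^ n) \<phi> field_differentiable (at x)" for n x
    using assms by (auto simp: test_function_def)
  have d: "((deriv ^^ n) \<phi> has_real_derivative (deriv ^^ (Suc n)) \<phi> x) (at x)" for n x
    using diff[of n x] by (simp add: field_differentiable_derivI)
  have "bounded {x. \<phi> x \<noteq> 0}"
    by (rule bounded_subset[OF compact_imp_bounded closure_subset])
      (use assms in \<open>simp add: test_function_def\<close>)
  then obtain B where B: "\<And>x. \<phi> x \<noteq> 0 \<Longrightarrow> \<bar>x\<bar> \<le> B"
    by (auto simp: bounded_iff)
  have zero: "(deriv ^^ n) \<phi> x = 0" if "\<bar>x\<bar> > B" for n x
    using that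
  proof (induction n arbitrary: x)
    case 0
    then show ?case using B[of x] by force
  next
    case (Suc n)
    have "open {x. \<bar>x\<bar> > B}"
      by (intro open_Collect_less continuous_intros)
    then have "\<forall>\<^sub>F y in nhds x. y \<in> {x. \<bar>x\<bar> > B}"
      by (rule eventually_nhds_in_open) (use Suc.prems in auto)
    then have ev: "\<forall>\<^sub>F y in nhds x. (deriv ^^ n) \<phi> y = 0"
      by eventually_elim (use Suc.IH in auto)
    have "((deriv ^^ n) \<phi> has_real_derivative 0) (at x)"
      by (rule DERIV_cong_ev[THEN iffD2, OF refl ev refl]) simp
    then show ?case
      by (rule DERIV_unique[OF d])
  qed
  have "continuous_on UNIV (deriv (deriv \<phi>))"
    using d[of 2] by (auto simp: numeral_2_eq_2 intro: DERIV_continuous_on has_field_derivative_at_within)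
  then show ?thesis
    using d[of 0] d[of 1] zero[of _ 0] zero[of _ 1] zero[of _ 2]
    by (intro that[of "\<bar>B\<bar> + 1"]) (auto simp: numeral_2_eq_2)
qed

text \<open>
  The exceptional set $E$ accommodates the primitive of $cV$, which has kinks at the two interfaces.
\<close>

lemma integral_by_parts_compact_support:
  fixes K k \<psi> \<psi>' :: "real \<Rightarrow> real"
  assumes "continuous_on UNIV K" "finite E" "\<And>x. x \<notin> E \<Longrightarrow> (K has_real_derivative k x) (at x)"
    and "\<And>x. (\<psi> has_real_derivative \<psi>' x) (at x)" "continuous_on UNIV \<psi>'" "M > 0"
    and "\<And>x. \<bar>x\<bar> \<ge> M \<Longrightarrow> \<psi> x = 0" "\<And>x. \<bar>x\<bar> \<ge> M \<Longrightarrow> \<psi>' x = 0"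
  shows "integral UNIV (\<lambda>x. k x * \<psi> x) = - integral UNIV (\<lambda>x. K x * \<psi>' x)"
proof -
  have cont\<psi>: "continuous_on UNIV \<psi>"
    using assms(4) by (auto intro: DERIV_continuous_on has_field_derivative_at_within)
  have "((\<lambda>x. k x * \<psi> x + K x * \<psi>' x) has_integral K M * \<psi> M - K (-M) * \<psi> (-M)) {-M..M}"
  proof (rule fundamental_theorem_of_calculus_interior_strong[OF assms(2)])
    show "((\<lambda>x. K x * \<psi> x) has_vector_derivative k x * \<psi> x + K x * \<psi>' x) (at x)"
      if "x \<in> {-M<..<M} - E" for x
      using assms(3)[of x] assms(4)[of x] that
      by (auto intro!: derivative_eq_intros simp flip: has_real_derivative_iff_has_vector_derivative)
    show "continuous_on {-M..M} (\<lambda>x. K x * \<psi> x)"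
      by (intro continuous_intros continuous_on_subset[OF assms(1)] continuous_on_subset[OF cont\<psi>]) auto
  qed (use \<open>M > 0\<close> in auto)
  moreover have K\<psi>': "((\<lambda>x. K x * \<psi>' x) has_integral integral {-M..M} (\<lambda>x. K x * \<psi>' x)) {-M..M}"
    by (intro integrable_integral integrable_continuous_real continuous_intros
        continuous_on_subset[OF assms(1)] continuous_on_subset[OF assms(5)]) auto
  ultimately have "((\<lambda>x. (k x * \<psi> x + K x * \<psi>' x) - K x * \<psi>' x) has_integral
      (K M * \<psi> M - K (-M) * \<psi> (-M)) - integral {-M..M} (\<lambda>x. K x * \<psi>' x)) {-M..M}"
    by (rule has_integral_diff)
  then have "((\<lambda>x. k x * \<psi> x) has_integral - integral {-M..M} (\<lambda>x. K x * \<psi>' x)) {-M..M}"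
    using \<open>M > 0\<close> assms(7)[of M] assms(7)[of "-M"] by simp
  then have "((\<lambda>x. k x * \<psi> x) has_integral - integral {-M..M} (\<lambda>x. K x * \<psi>' x)) UNIV"
    by (rule has_integral_on_superset) (use assms(7) in auto)
  moreover have "((\<lambda>x. K x * \<psi>' x) has_integral integral {-M..M} (\<lambda>x. K x * \<psi>' x)) UNIV"
    using K\<psi>' by (rule has_integral_on_superset) (use assms(8) in auto)
  ultimately show ?thesis
    by (simp add: integral_unique)
qed

text \<open>
  A continuous primitive of $cV$ in closed form: stop the primitive $U$ of $V$ at the two interfaces.
\<close>

lemma clamp_has_derivative:
  fixes U V :: "real \<Rightarrow> real"
  assumes "\<And>x. (U has_real_derivative V x) (at x)" "X \<noteq> -\<Xi>" "X \<noteq> \<Xi>" "\<Xi> > 0"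
  shows "((\<lambda>x. U (max (- \<Xi>) (min \<Xi> x)) / \<kappa>) has_real_derivative spinodal_coeff \<kappa> \<Xi> X * V X) (at X)"
proof -
  consider "X < -\<Xi>" | "X > \<Xi>" | "-\<Xi> < X" "X < \<Xi>"
    using assms by linarith
  then show ?thesis
  proof cases
    case 1
    have "((\<lambda>x. U (- \<Xi>) / \<kappa>) has_real_derivative spinodal_coeff \<kappa> \<Xi> X * V X) (at X)"
      using 1 by (simp add: spinodal_coeff_def)
    then show ?thesis
      by (rule DERIV_cong_ev[THEN iffD1, rotated -1])
        (use 1 assms(4) in \<open>auto intro!: eventually_mono[OF eventually_nhds_in_open[of "{..<-\<Xi>}" X]]\<close>)
  next
    case 2
    have "((\<lambda>x. U \<Xi> / \<kappa>) has_real_derivative spinodal_coeff \<kappa> \<Xi> X * V X) (at X)"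
      using 2 by (simp add: spinodal_coeff_def)
    then show ?thesis
      by (rule DERIV_cong_ev[THEN iffD1, rotated -1])
        (use 2 assms(4) in \<open>auto intro!: eventually_mono[OF eventually_nhds_in_open[of "{\<Xi><..}" X]]\<close>)
  next
    case 3
    have "((\<lambda>x. U x / \<kappa>) has_real_derivative spinodal_coeff \<kappa> \<Xi> X * V X) (at X)"
      using 3 DERIV_cdivide[OF assms(1)[of X], of \<kappa>] by (simp add: spinodal_coeff_def)
    then show ?thesis
      by (rule DERIV_cong_ev[THEN iffD1, rotated -1])
        (use 3 assms(4) in \<open>auto intro!: eventually_mono[OF eventually_nhds_in_open[of "{-\<Xi><..<\<Xi>}" X]]\<close>)
  qed
qed

text \<open>
  With $W'=U$, $U'=V$ and $K'=cV$, all terms of the weak equation can be brought by partial integration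
  into the form $\int H\varphi''=0$, where $H=\nu^2SV+U-SW-K$. Hence $H$ is affine, and solving for $V$
  exhibits it as a combination of functions that are differentiable away from the interfaces. The slope
  of $H$ is the constant $\beta$.
\<close>

lemma weak_wave_equation_imp_ode:
  assumes "\<nu> > 0" "S > 0" "\<Xi> > 0"
    and contV: "continuous_on UNIV V"
    and weak: "weak_wave_equation \<nu> \<kappa> S \<Xi> V"
    and U: "\<And>x. (U has_real_derivative V x) (at x)"
  obtains \<beta> where "\<And>X. X \<noteq> -\<Xi> \<Longrightarrow> X \<noteq> \<Xi> \<Longrightarrow>
    (V has_real_derivative (\<beta> + S * U X - V X + spinodal_coeff \<kappa> \<Xi> X * V X) / (\<nu>\<^sup>2 * S)) (at X)"
proof -
  have contU: "continuous_on UNIV U"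
    using U by (auto intro: DERIV_continuous_on has_field_derivative_at_within)
  obtain W where W: "\<And>x. (W has_real_derivative U x) (at x)"
    using continuous_has_primitive[OF contU] by metis
  have contW: "continuous_on UNIV W"
    using W by (auto intro: DERIV_continuous_on has_field_derivative_at_within)
  define K where "K x = U (max (- \<Xi>) (min \<Xi> x)) / \<kappa>" for x
  have K': "(K has_real_derivative spinodal_coeff \<kappa> \<Xi> x * V x) (at x)" if "x \<notin> {-\<Xi>, \<Xi>}" for x
    using clamp_has_derivative[OF U, of x \<Xi> \<kappa>] that \<open>\<Xi> > 0\<close> by (simp add: K_def[abs_def])
  have contK: "continuous_on UNIV K"
    unfolding K_def[abs_def] divide_inverse
    by (intro continuous_intros continuous_on_compose2[OF contU]) auto
  define H where "H x = \<nu>\<^sup>2 * S * V x + U x - S * W x - K x" for x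
  have contH: "continuous_on UNIV H"
    unfolding H_def[abs_def] by (intro continuous_intros contV contU contW contK)
  have "integral UNIV (\<lambda>x. H x * deriv (deriv \<phi>) x) = 0" if \<phi>: "test_function \<phi>" for \<phi>
  proof -
    obtain M where M: "M > 0"
      "\<And>x. (\<phi> has_real_derivative deriv \<phi> x) (at x)"
      "\<And>x. (deriv \<phi> has_real_derivative deriv (deriv \<phi>) x) (at x)"
      "continuous_on UNIV (deriv (deriv \<phi>))"
      "\<And>x. \<bar>x\<bar> \<ge> M \<Longrightarrow> \<phi> x = 0" "\<And>x. \<bar>x\<bar> \<ge> M \<Longrightarrow> deriv \<phi> x = 0"
      "\<And>x. \<bar>x\<bar> \<ge> M \<Longrightarrow> deriv (deriv \<phi>) x = 0"
      using test_functionE[OF \<phi>] by metis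
    have cont\<phi>': "continuous_on UNIV (deriv \<phi>)"
      using M(3) by (auto intro: DERIV_continuous_on has_field_derivative_at_within)
    have int: "(\<lambda>x. f x * deriv (deriv \<phi>) x) integrable_on UNIV" if "continuous_on UNIV f" for f
      by (rule has_integral_integrable, rule has_integral_UNIV_of_support[of _ "-M" M])
        (use that M(4,7) in \<open>auto intro!: continuous_intros\<close>)
    have 1: "integral UNIV (\<lambda>x. V x * \<phi> x) = - integral UNIV (\<lambda>x. U x * deriv \<phi> x)"
      by (rule integral_by_parts_compact_support[where E = "{}" and M = M])
        (use contU U M cont\<phi>' in auto)
    have 2: "integral UNIV (\<lambda>x. U x * deriv \<phi> x) = - integral UNIV (\<lambda>x. W x * deriv (deriv \<phi>) x)"
      by (rule integral_by_parts_compact_support[where E = "{}" and M = M])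
        (use contW W M in auto)
    have 3: "integral UNIV (\<lambda>x. (V x - spinodal_coeff \<kappa> \<Xi> x * V x) * deriv \<phi> x) =
        - integral UNIV (\<lambda>x. (U x - K x) * deriv (deriv \<phi>) x)"
      by (rule integral_by_parts_compact_support[where E = "{-\<Xi>, \<Xi>}" and M = M])
        (use contU contK U K' M in \<open>auto intro!: continuous_intros DERIV_diff\<close>)
    have 4: "integral UNIV (\<lambda>x. S * V x * \<phi> x) = S * integral UNIV (\<lambda>x. V x * \<phi> x)"
      by (simp add: mult.assoc)
    have 5: "integral UNIV (\<lambda>x. (U x - K x) * deriv (deriv \<phi>) x) =
        integral UNIV (\<lambda>x. U x * deriv (deriv \<phi>) x) - integral UNIV (\<lambda>x. K x * deriv (deriv \<phi>) x)"
      using integral_diff[OF int[OF contU] int[OF contK]] by (simp add: algebra_simps)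
    have "((\<lambda>x. \<nu>\<^sup>2 * S * (V x * deriv (deriv \<phi>) x) + U x * deriv (deriv \<phi>) x
        - S * (W x * deriv (deriv \<phi>) x) - K x * deriv (deriv \<phi>) x) has_integral
      \<nu>\<^sup>2 * S * integral UNIV (\<lambda>x. V x * deriv (deriv \<phi>) x)
        + integral UNIV (\<lambda>x. U x * deriv (deriv \<phi>) x)
        - S * integral UNIV (\<lambda>x. W x * deriv (deriv \<phi>) x)
        - integral UNIV (\<lambda>x. K x * deriv (deriv \<phi>) x)) UNIV"
      by (intro has_integral_add has_integral_diff has_integral_mult_right integrable_integral
          int contV contU contW contK)
    moreover have "(\<lambda>x. \<nu>\<^sup>2 * S * (V x * deriv (deriv \<phi>) x) + U x * deriv (deriv \<phi>) x
        - S * (W x * deriv (deriv \<phi>) x) - K x * deriv (deriv \<phi>) x) = (\<lambda>x. H x * deriv (deriv \<phi>) x)"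
      by (auto simp: H_def algebra_simps)
    moreover have "integral UNIV (\<lambda>x. S * V x * \<phi> x) - \<nu>\<^sup>2 * S * integral UNIV (\<lambda>x. V x * deriv (deriv \<phi>) x)
        = - integral UNIV (\<lambda>x. (V x - spinodal_coeff \<kappa> \<Xi> x * V x) * deriv \<phi> x)"
      using weak \<phi> by (auto simp: weak_wave_equation_def)
    ultimately show ?thesis
      using 1 2 3 4 5 by (simp add: integral_unique)
  qed
  then have H: "H x = H 0 + x * (H 1 - H 0)" for x
    by (rule affine_if_weak_second_derivative_0[OF contH])
  have V: "V = (\<lambda>x. (H 0 + x * (H 1 - H 0) - U x + S * W x + K x) / (\<nu>\<^sup>2 * S))"
  proof
    fix x
    have "\<nu>\<^sup>2 * S * V x = H 0 + x * (H 1 - H 0) - U x + S * W x + K x"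
      using H[of x] unfolding H_def[of x] by simp
    then show "V x = (H 0 + x * (H 1 - H 0) - U x + S * W x + K x) / (\<nu>\<^sup>2 * S)"
      using assms(1,2) by (simp add: field_simps)
  qed
  show ?thesis
  proof (rule that[of "H 1 - H 0"])
    fix X assume "X \<noteq> -\<Xi>" "X \<noteq> \<Xi>"
    then have "((\<lambda>x. (H 0 + x * (H 1 - H 0) - U x + S * W x + K x) / (\<nu>\<^sup>2 * S)) has_real_derivative
       ((H 1 - H 0) + S * U X - V X + spinodal_coeff \<kappa> \<Xi> X * V X) / (\<nu>\<^sup>2 * S)) (at X)"
      by (intro DERIV_cdivide) (auto intro!: derivative_eq_intros U W K')
    then show "(V has_real_derivative
       ((H 1 - H 0) + S * U X - V X + spinodal_coeff \<kappa> \<Xi> X * V X) / (\<nu>\<^sup>2 * S)) (at X)"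
      unfolding V[symmetric] .
  qed
qed

section \<open>Explicit solution of the wave problem\<close>

lemma exponential_if_derivative_proportional:
  fixes f :: "real \<Rightarrow> real"
  assumes "continuous_on {l..u} f" "\<And>x. l < x \<Longrightarrow> x < u \<Longrightarrow> (f has_real_derivative r * f x) (at x)"
    and "l \<le> u"
  shows "f u = f l * exp (r * (u - l))"
proof (cases "l = u")
  case False
  then have "l < u" using assms(3) by simp
  then have "f u * exp (- r * (u - l)) = f l * exp (- r * (l - l))"
  proof (rule DERIV_isconst_end)
    show "continuous_on {l..u} (\<lambda>x. f x * exp (- r * (x - l)))"
      by (intro continuous_intros assms)
    show "((\<lambda>x. f x * exp (- r * (x - l))) has_real_derivative 0) (at x)" if "l < x" "x < u" for x
      by (rule derivative_eq_intros assms(2) that refl | simp)+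
  qed
  then have "f l = f u / exp (r * (u - l))"
    by (simp add: exp_minus divide_inverse)
  then show ?thesis by simp
qed simp

text \<open>
  The system $Z'=V$, $V'=(r+s)V-rsZ$ has the characteristic exponents $r$ and $s$, and $(-s,1)$ is a left
  eigenvector for $r$. Using this once for $(r,s)$ and once for $(s,r)$ replaces the general solution
  and its undetermined coefficients.
\<close>

lemma eigenmode_evolution:
  fixes Z V :: "real \<Rightarrow> real"
  assumes "continuous_on {l..u} Z" "continuous_on {l..u} V" "l \<le> u"
    and "\<And>x. l < x \<Longrightarrow> x < u \<Longrightarrow> (Z has_real_derivative V x) (at x)"
    and "\<And>x. l < x \<Longrightarrow> x < u \<Longrightarrow> (V has_real_derivative (r + s) * V x - r * s * Z x) (at x)"
  shows "V u - s * Z u = (V l - s * Z l) * exp (r * (u - l))"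
proof (rule exponential_if_derivative_proportional[where f = "\<lambda>x. V x - s * Z x"])
  show "continuous_on {l..u} (\<lambda>x. V x - s * Z x)"
    by (intro continuous_intros assms)
  show "((\<lambda>x. V x - s * Z x) has_real_derivative r * (V x - s * Z x)) (at x)"
    if "l < x" "x < u" for x
    by (rule DERIV_cong[OF DERIV_diff[OF assms(5)[OF that] DERIV_cmult[OF assms(4)[OF that]]]])
      (simp add: algebra_simps)
qed (rule assms)

lemma relevant_wave_left:
  assumes wave: "relevant_traveling_wave \<nu> \<kappa> S \<eta> \<Xi> V" and profile: "wave_profile \<kappa> \<Xi> V U"
    and \<alpha>: "\<alpha> = lambda_plus \<nu> S" "\<alpha> > 0" and X: "X \<le> -\<Xi>"
  shows "U X = - \<kappa> - \<eta> / \<alpha> * (1 - exp (\<alpha> * (X + \<Xi>)))"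
proof -
  have "\<exists>c. \<forall>x\<in>{..-\<Xi>}. U x - \<eta> / \<alpha> * exp (\<alpha> * (x + \<Xi>)) = c"
  proof (rule has_field_derivative_zero_constant)
    fix x assume "x \<in> {..-\<Xi>}"
    then have "(U has_real_derivative \<eta> * exp (\<alpha> * (x + \<Xi>))) (at x within {..-\<Xi>})"
      using wave profile \<alpha>(1)
      by (auto simp: relevant_traveling_wave_def wave_profile_def intro: has_field_derivative_at_within)
        (metis has_field_derivative_at_within)
    then show "((\<lambda>x. U x - \<eta> / \<alpha> * exp (\<alpha> * (x + \<Xi>))) has_real_derivative 0) (at x within {..-\<Xi>})"
      using \<alpha>(2) by (auto intro!: derivative_eq_intros)
  qed (auto simp: convex_real_interval)
  then obtain c where c: "\<And>x. x \<le> -\<Xi> \<Longrightarrow> U x - \<eta> / \<alpha> * exp (\<alpha> * (x + \<Xi>)) = c"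
    by auto
  then show ?thesis
    using c[of "-\<Xi>"] c[of X] X profile by (simp add: wave_profile_def algebra_simps)
qed

text \<open>
  The prescribed exponential on the left determines the integration constant: it is the one for which
  $Z=U+\kappa+\eta/\alpha$ satisfies the homogeneous system $Z'=V$, $\nu^2SV'=SZ-V+cV$.
\<close>

lemma relevant_wave_ode:
  assumes wave: "relevant_traveling_wave \<nu> \<kappa> S \<eta> \<Xi> V" and profile: "wave_profile \<kappa> \<Xi> V U"
    and \<alpha>: "\<alpha> = lambda_plus \<nu> S" "\<alpha> > 0" "\<nu>\<^sup>2 * S * \<alpha>\<^sup>2 = S - \<alpha>" and pos: "\<nu> > 0" "S > 0"
    and X: "X \<noteq> -\<Xi>" "X \<noteq> \<Xi>"
  shows "(V has_real_derivative (S * (U X + \<kappa> + \<eta> / \<alpha>) - V X + spinodal_coeff \<kappa> \<Xi> X * V X)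
    / (\<nu>\<^sup>2 * S)) (at X)"
proof -
  have \<Xi>: "\<Xi> > 0" and left: "\<And>X. X \<le> -\<Xi> \<Longrightarrow> V X = \<eta> * exp (\<alpha> * (X + \<Xi>))"
    using wave \<alpha>(1) by (auto simp: relevant_traveling_wave_def)
  obtain \<beta> where \<beta>: "\<And>X. X \<noteq> -\<Xi> \<Longrightarrow> X \<noteq> \<Xi> \<Longrightarrow>
    (V has_real_derivative (\<beta> + S * U X - V X + spinodal_coeff \<kappa> \<Xi> X * V X) / (\<nu>\<^sup>2 * S)) (at X)"
    using weak_wave_equation_imp_ode[OF pos \<Xi>, of V \<kappa> U] wave profile
    by (auto simp: relevant_traveling_wave_def traveling_wave_solution_def wave_profile_def)
  (* Any point to the left of the interface serves to compute the constant. *)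
  define Y where "Y = -\<Xi> - 1"
  define e where "e = exp (\<alpha> * (Y + \<Xi>))"
  have Y: "Y < -\<Xi>" "Y \<noteq> \<Xi>" using \<Xi> by (auto simp: Y_def)
  have "((\<lambda>X. \<eta> * exp (\<alpha> * (X + \<Xi>))) has_real_derivative \<eta> * (\<alpha> * e)) (at Y)"
    by (auto intro!: derivative_eq_intros simp: e_def)
  then have "(V has_real_derivative \<eta> * (\<alpha> * e)) (at Y)"
    by (rule DERIV_cong_ev[THEN iffD1, rotated -1])
      (use Y left in \<open>auto intro!: eventually_mono[OF eventually_nhds_in_open[of "{..<-\<Xi>}" Y]]\<close>)
  moreover have "(V has_real_derivative (\<beta> + S * U Y - V Y) / (\<nu>\<^sup>2 * S)) (at Y)"
    using \<beta>[of Y] Y by (simp add: spinodal_coeff_def)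
  ultimately have "(\<beta> + S * U Y - V Y) / (\<nu>\<^sup>2 * S) = \<eta> * (\<alpha> * e)"
    by (rule DERIV_unique[symmetric])
  then have "\<beta> + S * U Y - V Y = \<eta> * \<alpha> * e * (\<nu>\<^sup>2 * S)"
    using pos by (simp add: field_simps)
  moreover have "U Y = - \<kappa> - \<eta> / \<alpha> * (1 - e)" "V Y = \<eta> * e"
    using relevant_wave_left[OF wave profile \<alpha>(1,2), of Y] left[of Y] Y by (auto simp: e_def)
  moreover have "\<eta> * \<alpha> * e * (\<nu>\<^sup>2 * S) = \<eta> * e / \<alpha> * (S - \<alpha>)"
    unfolding \<alpha>(3)[symmetric] using \<alpha>(2) by (simp add: field_simps power2_eq_square)
  ultimately have "\<beta> = S * (\<kappa> + \<eta> / \<alpha>)"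
    using \<alpha>(2) by (simp add: field_simps)
  then show ?thesis
    using \<beta>[OF X] by (simp add: algebra_simps)
qed

lemma profile_at_right_interface:
  assumes wave: "relevant_traveling_wave \<nu> \<kappa> S \<eta> \<Xi> V" and profile: "wave_profile \<kappa> \<Xi> V U"
  shows "U \<Xi> = \<kappa>"
proof -
  have "(V has_integral U \<Xi> - U (-\<Xi>)) {-\<Xi>..\<Xi>}"
    by (rule fundamental_theorem_of_calculus)
      (use wave profile in \<open>auto simp: relevant_traveling_wave_def wave_profile_def
        intro: has_vector_derivative_at_within simp flip: has_real_derivative_iff_has_vector_derivative\<close>,
        metis has_field_derivative_at_within)
  then show ?thesis
    using wave profile
    by (auto simp: relevant_traveling_wave_def traveling_wave_solution_def wave_profile_def
        dest: integral_unique)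
qed

text \<open>
  The exponents are $m=\mu_+$, $-n=\mu_-$ in the interval $[-\Xi,\Xi]$ and $\alpha=\lambda_+$, $-p=\lambda_-$
  outside of it; the assumptions on them are Vieta's formulas. Both eigenmodes start with known values
  at $-\Xi$, so the two of them give two equations at $\Xi$, where $Z$ is known from the integral
  constraint. Eliminating $V(\Xi)$ leaves one equation for the interface parameter. The constant $v$ is
  $V(\Xi)$, expressed through the mode that decays in $[-\Xi,\Xi]$, whose exponential stays
  bounded as $\nu\to0$.
\<close>

lemma relevant_wave_explicit:
  assumes wave: "relevant_traveling_wave \<nu> \<kappa> S \<eta> \<Xi> V" and profile: "wave_profile \<kappa> \<Xi> V U"
    and \<alpha>: "\<alpha> = lambda_plus \<nu> S" "\<alpha> > 0" and pos: "\<nu> > 0" "S > 0" "\<kappa> > 0"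
    and p: "\<alpha> * p = 1 / \<nu>\<^sup>2" "\<alpha> - p = - 1 / (\<nu>\<^sup>2 * S)"
    and mn: "m * n = 1 / \<nu>\<^sup>2" "m - n = (1 - \<kappa>) / (\<nu>\<^sup>2 * S * \<kappa>)"
  defines "Z \<equiv> 2 * \<kappa> + \<eta> / \<alpha>"
  defines "v \<equiv> m * Z + \<eta> * (1 - m / \<alpha>) * exp (- (2 * n * \<Xi>))"
  shows "(m + n) * Z = \<eta> * (1 + n / \<alpha>) * exp (2 * m * \<Xi>) + \<eta> * (m / \<alpha> - 1) * exp (- (2 * n * \<Xi>))"
    and "X \<ge> \<Xi> \<Longrightarrow> (\<alpha> + p) * (U X + \<kappa> + \<eta> / \<alpha>) =
      (v + p * Z) * exp (\<alpha> * (X - \<Xi>)) - (v - \<alpha> * Z) * exp (- (p * (X - \<Xi>)))"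
proof -
  define \<zeta> where "\<zeta> x = U x + \<kappa> + \<eta> / \<alpha>" for x
  have \<Xi>: "\<Xi> > 0" and contV: "continuous_on A V" for A
    using wave continuous_on_subset
    by (auto simp: relevant_traveling_wave_def traveling_wave_solution_def)
  have \<zeta>': "(\<zeta> has_real_derivative V x) (at x)" for x
    using profile unfolding \<zeta>_def[abs_def] wave_profile_def by (auto intro!: derivative_eq_intros)
  then have cont\<zeta>: "continuous_on A \<zeta>" for A
    by (auto intro: DERIV_continuous_on has_field_derivative_at_within)
  have "V (-\<Xi>) = \<eta>"
    using wave by (auto simp: relevant_traveling_wave_def)
  have \<zeta>l: "\<zeta> (-\<Xi>) = \<eta> / \<alpha>" using profile by (simp add: \<zeta>_def wave_profile_def)
  have \<zeta>r: "\<zeta> \<Xi> = Z"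
    using profile_at_right_interface[OF wave profile] by (simp add: \<zeta>_def Z_def)
  have char: "\<nu>\<^sup>2 * S * \<alpha>\<^sup>2 = S - \<alpha>"
  proof -
    have "\<nu>\<^sup>2 * S * (\<alpha> * (\<alpha> - p)) = - \<alpha>" "\<nu>\<^sup>2 * S * (\<alpha> * p) = S"
      using pos unfolding p by (auto simp: field_simps)
    then show ?thesis by (simp add: algebra_simps power2_eq_square)
  qed
  have ode: "(V has_real_derivative (S * \<zeta> x - V x + spinodal_coeff \<kappa> \<Xi> x * V x) / (\<nu>\<^sup>2 * S)) (at x)"
    if "x \<noteq> -\<Xi>" "x \<noteq> \<Xi>" for x
    using relevant_wave_ode[OF wave profile \<alpha> char pos(1,2) that] by (simp add: \<zeta>_def)
  have inner: "(V has_real_derivative (m - n) * V x + m * n * \<zeta> x) (at x)" if "-\<Xi> < x" "x < \<Xi>" for x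
    using ode[of x] that pos unfolding mn
    by (auto simp: spinodal_coeff_def field_simps elim!: DERIV_cong)
  have outer: "(V has_real_derivative (\<alpha> - p) * V x + \<alpha> * p * \<zeta> x) (at x)" if "\<Xi> < x" for x
    using ode[of x] that pos \<Xi> unfolding p
    by (auto simp: spinodal_coeff_def field_simps elim!: DERIV_cong)
  have 1: "V \<Xi> + n * Z = (\<eta> + n * (\<eta> / \<alpha>)) * exp (2 * m * \<Xi>)"
    using eigenmode_evolution[of "-\<Xi>" \<Xi> \<zeta> V m "- n"] cont\<zeta> contV \<Xi> \<zeta>' inner
    by (simp add: \<zeta>l \<zeta>r \<open>V (-\<Xi>) = \<eta>\<close> algebra_simps)
  have 2: "V \<Xi> - m * Z = (\<eta> - m * (\<eta> / \<alpha>)) * exp (- (2 * n * \<Xi>))"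
    using eigenmode_evolution[of "-\<Xi>" \<Xi> \<zeta> V "- n" m] cont\<zeta> contV \<Xi> \<zeta>' inner
    by (simp add: \<zeta>l \<zeta>r \<open>V (-\<Xi>) = \<eta>\<close> algebra_simps)
  show "(m + n) * Z = \<eta> * (1 + n / \<alpha>) * exp (2 * m * \<Xi>) + \<eta> * (m / \<alpha> - 1) * exp (- (2 * n * \<Xi>))"
    using 1 2 by (simp add: algebra_simps)
  have v: "V \<Xi> = v"
    using 2 by (simp add: v_def algebra_simps)
  show "(\<alpha> + p) * (U X + \<kappa> + \<eta> / \<alpha>) =
      (v + p * Z) * exp (\<alpha> * (X - \<Xi>)) - (v - \<alpha> * Z) * exp (- (p * (X - \<Xi>)))" if "X \<ge> \<Xi>"
  proof -
    have "V X + p * \<zeta> X = (v + p * Z) * exp (\<alpha> * (X - \<Xi>))"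
      using eigenmode_evolution[of \<Xi> X \<zeta> V \<alpha> "- p"] cont\<zeta> contV that \<zeta>' outer
      by (simp add: \<zeta>r v algebra_simps)
    moreover have "V X - \<alpha> * \<zeta> X = (v - \<alpha> * Z) * exp (- (p * (X - \<Xi>)))"
      using eigenmode_evolution[of \<Xi> X \<zeta> V "- p" \<alpha>] cont\<zeta> contV that \<zeta>' outer
      by (simp add: \<zeta>r v algebra_simps)
    ultimately have "(\<alpha> + p) * \<zeta> X =
        (v + p * Z) * exp (\<alpha> * (X - \<Xi>)) - (v - \<alpha> * Z) * exp (- (p * (X - \<Xi>)))"
      by (simp add: distrib_right)
    then show ?thesis
      by (simp add: \<zeta>_def)
  qed
qed

section \<open>Expansion of the exponential rates\<close>

text \<open>
  The positive root of $g^2=g+t$. All four exponents are elementary multiples of its values, or of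
  their inverses, at arguments $t$ of order $\nu^2$. The bounds $1\le g\le1+t$ then give the expansions with explicit
  error terms.
\<close>

definition char_root :: "real \<Rightarrow> real" where
  "char_root t = (1 + sqrt (1 + 4 * t)) / 2"

lemma char_root_eq: "t \<ge> 0 \<Longrightarrow> (char_root t)\<^sup>2 = char_root t + t"
  by (simp add: char_root_def power2_eq_square field_simps)

lemma char_root_ge_1: "t \<ge> 0 \<Longrightarrow> char_root t \<ge> 1"
  by (simp add: char_root_def)

lemma char_root_le: "t \<ge> 0 \<Longrightarrow> char_root t \<le> 1 + t"
  using char_root_eq[of t] char_root_ge_1[of t]
    mult_left_mono[of 1 "char_root t" "char_root t - 1"]
  by (simp add: power2_eq_square algebra_simps)

lemma char_root_tendsto: "((\<lambda>\<nu>. char_root (c * \<nu>\<^sup>2)) \<longlongrightarrow> 1) (at_right 0)"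
proof -
  have "((\<lambda>\<nu>. char_root (c * \<nu>\<^sup>2)) \<longlongrightarrow> char_root (c * 0\<^sup>2)) (at_right 0)"
    unfolding char_root_def by (intro tendsto_intros) simp
  then show ?thesis by (simp add: char_root_def)
qed

text \<open>
  The moduli of the two exponents of $\nu^2Sy''=\pm cy'+Sy$. The slow one stays bounded as $\nu\to0$, the
  fast one grows like $\nu^{-2}$. With $c=1$ they are $\lambda_+$ and $-\lambda_-$, with $c=(1-\kappa)/\kappa$
  they are $-\mu_-$ and $\mu_+$: inside $[-\Xi,\Xi]$ the growing mode is the fast one, outside it is the slow
  one.
\<close>

definition slow_rate :: "real \<Rightarrow> real \<Rightarrow> real \<Rightarrow> real" where
  "slow_rate S c \<nu> = S / (c * char_root ((S / c)\<^sup>2 * \<nu>\<^sup>2))"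

definition fast_rate :: "real \<Rightarrow> real \<Rightarrow> real \<Rightarrow> real" where
  "fast_rate S c \<nu> = c * char_root ((S / c)\<^sup>2 * \<nu>\<^sup>2) / (\<nu>\<^sup>2 * S)"

lemma lambda_plus_eq_slow_rate:
  assumes "\<nu> > 0" "S > 0"
  shows "lambda_plus \<nu> S = slow_rate S 1 \<nu>"
proof -
  have "(1 / (2 * \<nu>\<^sup>2 * S))\<^sup>2 + 1 / \<nu>\<^sup>2 = (1 + 4 * (S\<^sup>2 * \<nu>\<^sup>2)) / (2 * \<nu>\<^sup>2 * S)\<^sup>2"
    using assms by (simp add: field_simps power2_eq_square)
  then have "sqrt ((1 / (2 * \<nu>\<^sup>2 * S))\<^sup>2 + 1 / \<nu>\<^sup>2) = sqrt (1 + 4 * (S\<^sup>2 * \<nu>\<^sup>2)) / (2 * \<nu>\<^sup>2 * S)"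
    using assms by (simp add: real_sqrt_divide)
  then have "lambda_plus \<nu> S = (sqrt (1 + 4 * (S\<^sup>2 * \<nu>\<^sup>2)) - 1) / (2 * \<nu>\<^sup>2 * S)"
    by (simp add: lambda_plus_def diff_divide_distrib)
  also have "\<dots> = (char_root (S\<^sup>2 * \<nu>\<^sup>2) - 1) / (\<nu>\<^sup>2 * S)"
    using assms by (simp add: char_root_def divide_simps)
  finally have "lambda_plus \<nu> S = (char_root (S\<^sup>2 * \<nu>\<^sup>2) - 1) / (\<nu>\<^sup>2 * S)" .
  moreover have "(char_root (S\<^sup>2 * \<nu>\<^sup>2) - 1) * char_root (S\<^sup>2 * \<nu>\<^sup>2) = S * (\<nu>\<^sup>2 * S)"
  proof -
    have "(char_root (S\<^sup>2 * \<nu>\<^sup>2))\<^sup>2 = char_root (S\<^sup>2 * \<nu>\<^sup>2) + S\<^sup>2 * \<nu>\<^sup>2"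
      by (rule char_root_eq) simp
    then show ?thesis by (simp add: algebra_simps power2_eq_square)
  qed
  moreover have "char_root (S\<^sup>2 * \<nu>\<^sup>2) \<noteq> 0" "\<nu>\<^sup>2 * S \<noteq> 0"
    using assms char_root_ge_1[of "S\<^sup>2 * \<nu>\<^sup>2"] by auto
  ultimately have "lambda_plus \<nu> S = S / char_root (S\<^sup>2 * \<nu>\<^sup>2)"
    by (metis frac_eq_eq)
  then show ?thesis
    by (simp add: slow_rate_def)
qed

lemma rates_vieta:
  assumes "\<nu> > 0" "S > 0" "c > 0"
  shows "slow_rate S c \<nu> * fast_rate S c \<nu> = 1 / \<nu>\<^sup>2"
    and "fast_rate S c \<nu> - slow_rate S c \<nu> = c / (\<nu>\<^sup>2 * S)"
proof -
  define G where "G = char_root ((S / c)\<^sup>2 * \<nu>\<^sup>2)"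
  have G: "G \<ge> 1" "G\<^sup>2 = G + (S / c)\<^sup>2 * \<nu>\<^sup>2"
    using char_root_ge_1 char_root_eq by (auto simp: G_def)
  show "slow_rate S c \<nu> * fast_rate S c \<nu> = 1 / \<nu>\<^sup>2"
    using assms G(1) by (simp add: slow_rate_def fast_rate_def flip: G_def)
  have "c\<^sup>2 * G\<^sup>2 - \<nu>\<^sup>2 * S\<^sup>2 = c\<^sup>2 * G"
    unfolding G(2) using assms by (simp add: field_simps)
  moreover have "c * G / (\<nu>\<^sup>2 * S) - S / (c * G) = (c\<^sup>2 * G\<^sup>2 - \<nu>\<^sup>2 * S\<^sup>2) / (\<nu>\<^sup>2 * S * c * G)"
    using assms G(1) by (simp add: field_simps power2_eq_square)
  ultimately have "c * G / (\<nu>\<^sup>2 * S) - S / (c * G) = c / (\<nu>\<^sup>2 * S)"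
    using assms G(1) by (simp add: field_simps power2_eq_square)
  then show "fast_rate S c \<nu> - slow_rate S c \<nu> = c / (\<nu>\<^sup>2 * S)"
    by (simp add: slow_rate_def fast_rate_def G_def)
qed

lemma rates_pos:
  assumes "S > 0" "c > 0" "\<nu> > 0"
  shows "slow_rate S c \<nu> > 0" "fast_rate S c \<nu> > 0"
proof -
  have "char_root ((S / c)\<^sup>2 * \<nu>\<^sup>2) \<ge> 1"
    by (intro char_root_ge_1) simp
  then show "slow_rate S c \<nu> > 0" "fast_rate S c \<nu> > 0"
    using assms by (auto simp: slow_rate_def fast_rate_def)
qed

lemma slow_rate_tendsto:
  assumes "c > 0"
  shows "(slow_rate S c \<longlongrightarrow> S / c) (at_right 0)"
proof -
  have "((\<lambda>\<nu>. S / (c * char_root ((S / c)\<^sup>2 * \<nu>\<^sup>2))) \<longlongrightarrow> S / (c * 1)) (at_right 0)"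
    by (intro tendsto_intros char_root_tendsto) (use assms in simp)
  then show ?thesis by (simp add: slow_rate_def[abs_def])
qed

lemma fast_rate_tendsto:
  assumes "S > 0"
  shows "((\<lambda>\<nu>. \<nu>\<^sup>2 * fast_rate S c \<nu>) \<longlongrightarrow> c / S) (at_right 0)"
proof -
  have "((\<lambda>\<nu>. c * char_root ((S / c)\<^sup>2 * \<nu>\<^sup>2) / S) \<longlongrightarrow> c * 1 / S) (at_right 0)"
    by (intro tendsto_intros char_root_tendsto) (use assms in simp)
  moreover have "\<forall>\<^sub>F \<nu> in at_right 0. c * char_root ((S / c)\<^sup>2 * \<nu>\<^sup>2) / S = \<nu>\<^sup>2 * fast_rate S c \<nu>"
    by (rule eventually_at_rightI[of 0 1]) (auto simp: fast_rate_def)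
  ultimately show ?thesis
    by (simp add: tendsto_cong)
qed

lemma inverse_char_root_bigo: "(\<lambda>\<nu>. 1 / char_root (c\<^sup>2 * \<nu>\<^sup>2) - 1) \<in> O[at_right 0](\<lambda>\<nu>. \<nu>\<^sup>2)"
proof (rule bigoI[of _ "c\<^sup>2"], rule always_eventually, rule allI)
  fix \<nu> :: real
  have "char_root (c\<^sup>2 * \<nu>\<^sup>2) \<ge> 1" "char_root (c\<^sup>2 * \<nu>\<^sup>2) \<le> 1 + c\<^sup>2 * \<nu>\<^sup>2"
    by (auto intro!: char_root_ge_1 char_root_le)
  moreover have "G - 1 \<le> t \<Longrightarrow> \<bar>1 / G - 1\<bar> \<le> t" if "G \<ge> 1" for G t :: real
  proof -
    assume "G - 1 \<le> t"
    have "\<bar>1 / G - 1\<bar> = (G - 1) / G" using that by (simp add: field_simps abs_if)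
    also have "\<dots> \<le> G - 1" using that mult_left_mono[of 1 G "G - 1"] by (simp add: divide_le_eq)
    finally show ?thesis using \<open>G - 1 \<le> t\<close> by simp
  qed
  ultimately show "norm (1 / char_root (c\<^sup>2 * \<nu>\<^sup>2) - 1) \<le> c\<^sup>2 * norm (\<nu>\<^sup>2)"
    by simp
qed

section \<open>Asymptotics of the interface parameter\<close>

text \<open>
  In the limit $s=t=0$ the argument of the logarithm is $1$. Writing $G,H$ for the roots at $s,t$, it equals
  $H^2/B$ with $B=(aH+G)/(a+1)$, and both $H$ and $B$ lie between $1$ and $1$ plus a small number.
\<close>

lemma abs_ln_amplitude_ratio_le:
  fixes a s t :: real
  assumes "a > 0" "s \<ge> 0" "t \<ge> 0"
  shows "\<bar>ln (char_root t * (1 + 1 / a) / (1 + char_root s / (a * char_root t)))\<bar> \<le> s + 2 * t"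
proof -
  define G H where "G = char_root s" and "H = char_root t"
  have G: "1 \<le> G" "G \<le> 1 + s" and H: "1 \<le> H" "H \<le> 1 + t"
    using assms char_root_ge_1 char_root_le by (auto simp: G_def H_def)
  define B where "B = (a * H + G) / (a + 1)"
  have "a * 1 + 1 \<le> a * H + G"
    using assms G H by (intro add_mono mult_left_mono) auto
  then have B: "B \<ge> 1"
    using assms by (simp add: B_def)
  have B_le: "B \<le> 1 + (s + t)"
  proof -
    have "a * H + G \<le> a * (1 + t) + (1 + s)"
      using assms G H by (intro add_mono mult_left_mono) auto
    also have "\<dots> \<le> (1 + (s + t)) * (a + 1)"
      using assms by (simp add: algebra_simps)
    finally show ?thesis using assms by (simp add: B_def divide_le_eq)
  qed
  have "H * (1 + 1 / a) / (1 + G / (a * H)) = H\<^sup>2 / B"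
  proof -
    have "1 + G / (a * H) = (a * H + G) / (a * H)" "1 + 1 / a = (a + 1) / a"
      using assms H by (auto simp: field_simps)
    then show ?thesis using assms H by (simp add: B_def power2_eq_square)
  qed
  moreover have "ln (H\<^sup>2 / B) = 2 * ln H - ln B"
    using B H by (simp add: ln_div ln_realpow)
  moreover have "0 \<le> ln H" "ln H \<le> t" "0 \<le> ln B" "ln B \<le> s + t"
    using B B_le H ln_le_minus_one[of H] ln_le_minus_one[of B] by auto
  ultimately show ?thesis
    using assms unfolding G_def[symmetric] H_def[symmetric] by (simp add: abs_le_iff)
qed

text \<open>
  The dominant balance is $\eta(1+n/\alpha)e^{2m\Xi}\approx2\kappa m$. The remainder $w$ collects all other
  terms relative to $2\kappa m$. The terms $\pm\eta m/\alpha$, which are as large as the dominant one, are paired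
  into the factor $1-F$, which is small once $\Xi$ is known to be small.
\<close>

lemma interface_equation_log:
  fixes m n \<alpha> \<eta> \<kappa> \<Xi> F :: real
  assumes pos: "m > 0" "n > 0" "\<alpha> > 0" "\<eta> > 0" "\<kappa> > 0"
    and F: "F = exp (- (2 * n * \<Xi>))" "0 \<le> \<Xi>"
    and eq: "(m + n) * (2 * \<kappa> + \<eta> / \<alpha>) = \<eta> * (1 + n / \<alpha>) * exp (2 * m * \<Xi>) + \<eta> * (m / \<alpha> - 1) * F"
  defines "w \<equiv> n / m + \<eta> / (2 * \<kappa> * \<alpha>) * (1 - F) + (\<eta> * n / \<alpha> + \<eta> * F) / (2 * \<kappa> * m)"
  shows "w \<ge> 0" "2 * m * \<Xi> = ln (2 * \<kappa> * m / (\<eta> * (1 + n / \<alpha>))) + ln (1 + w)"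
proof -
  have F01: "0 < F" "F \<le> 1" using F pos by auto
  have quotient: "E = c / q * x" if "q > 0" "q * E = c * x" for q E c x :: real
    using that by (simp add: field_simps)
  have log_product: "x = ln c + ln (1 + y)" if "exp x = c * (1 + y)" "c > 0" "y \<ge> 0" for x c y :: real
    using that by (metis ln_exp ln_mult_pos add_pos_nonneg zero_less_one)
  show w: "w \<ge> 0"
    unfolding w_def using pos F01 by (intro add_nonneg_nonneg mult_nonneg_nonneg divide_nonneg_nonneg) auto
  have "\<eta> * (1 + n / \<alpha>) * exp (2 * m * \<Xi>) = 2 * \<kappa> * m * (1 + w)"
  proof -
    have "2 * \<kappa> * m * (1 + w) =
        2 * \<kappa> * m + 2 * \<kappa> * n + \<eta> * m / \<alpha> * (1 - F) + \<eta> * n / \<alpha> + \<eta> * F"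
      using pos unfolding w_def by (simp add: field_simps)
    then show ?thesis
      using eq by (simp add: algebra_simps add_divide_distrib diff_divide_distrib)
  qed
  moreover have "1 + n / \<alpha> > 0"
    using pos by (simp add: add_pos_pos)
  ultimately have "exp (2 * m * \<Xi>) = 2 * \<kappa> * m / (\<eta> * (1 + n / \<alpha>)) * (1 + w)"
    using quotient[of "\<eta> * (1 + n / \<alpha>)"] pos by simp
  moreover have "2 * \<kappa> * m / (\<eta> * (1 + n / \<alpha>)) > 0"
    using pos \<open>1 + n / \<alpha> > 0\<close> by simp
  ultimately show "2 * m * \<Xi> = ln (2 * \<kappa> * m / (\<eta> * (1 + n / \<alpha>))) + ln (1 + w)"
    using w log_product by blast
qed

text \<open>
  Taking logarithms, $2m\Xi=L+D$ with $L=\ln(2(1-\kappa)^2/(\nu^2S\eta))$ and $D=\ln A+\ln(1+w)$, where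
  $\ln A=O(\nu^2)$ accounts for the expansions of the exponents. The remainder $w$ contains $1-F$ and hence
  $\Xi$ itself, so the estimate is a bootstrap. First, $0\le1-F\le1$ gives $D=O(1)$ and thereby
  $\Xi=O(\nu^2L)$; then $1-F\le2n\Xi$ improves this to $D=O(\nu^2L)$. As $D$ is divided by $L$ in the relative
  error, the logarithm disappears and $O(\nu^2)$ remains.
\<close>

lemma interface_width_asymptotics:
  fixes \<Xi> :: "real \<Rightarrow> real" and \<kappa> S \<eta> a :: real
  assumes pos: "0 < \<kappa>" "\<kappa> < 1" "S > 0" "\<eta> > 0" and a: "a = (1 - \<kappa>) / \<kappa>"
    and \<Xi>_pos: "\<And>\<nu>. \<nu> > 0 \<Longrightarrow> \<Xi> \<nu> > 0"
    and eq: "\<And>\<nu>. \<nu> > 0 \<Longrightarrow>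
      (fast_rate S a \<nu> + slow_rate S a \<nu>) * (2 * \<kappa> + \<eta> / slow_rate S 1 \<nu>) =
      \<eta> * (1 + slow_rate S a \<nu> / slow_rate S 1 \<nu>) * exp (2 * fast_rate S a \<nu> * \<Xi> \<nu>)
      + \<eta> * (fast_rate S a \<nu> / slow_rate S 1 \<nu> - 1) * exp (- (2 * slow_rate S a \<nu> * \<Xi> \<nu>))"
  shows "(\<Xi> \<longlongrightarrow> 0) (at_right 0)"
    and "\<exists>r. r \<in> O[at_right 0](\<lambda>\<nu>. \<nu>\<^sup>2) \<and> (\<forall>\<^sub>F \<nu> in at_right 0.
       \<Xi> \<nu> = \<nu>\<^sup>2 * S * \<kappa> / (2 * (1 - \<kappa>)) * ln (2 * (1 - \<kappa>)\<^sup>2 / (\<nu>\<^sup>2 * S * \<eta>)) * (1 + r \<nu>))"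
proof -
  define m where "m = fast_rate S a"
  define n where "n = slow_rate S a"
  define \<alpha> where "\<alpha> = slow_rate S 1"
  define L where "L \<nu> = ln (2 * (1 - \<kappa>)\<^sup>2 / (\<nu>\<^sup>2 * S * \<eta>))" for \<nu>
  define F where "F \<nu> = exp (- (2 * n \<nu> * \<Xi> \<nu>))" for \<nu>
  define w where "w \<nu> = n \<nu> * (1 / m \<nu>) + \<eta> / (2 * \<kappa>) * (1 / \<alpha> \<nu>) * (1 - F \<nu>)
    + 1 / (2 * \<kappa>) * (\<eta> * (n \<nu> * (1 / \<alpha> \<nu>)) + \<eta> * F \<nu>) * (1 / m \<nu>)" for \<nu>
  define G where "G \<nu> = char_root ((S / a)\<^sup>2 * \<nu>\<^sup>2)" for \<nu>
  define A where "A \<nu> = G \<nu> * (1 + 1 / a) / (1 + char_root (S\<^sup>2 * \<nu>\<^sup>2) / (a * G \<nu>))" for \<nu>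
  define D where "D \<nu> = ln (A \<nu>) + ln (1 + w \<nu>)" for \<nu>
  have apos: "a > 0" using pos a by simp
  have mn: "m \<nu> > 0" "n \<nu> > 0" "\<alpha> \<nu> > 0" if "\<nu> > 0" for \<nu>
    using rates_pos[OF pos(3) _ that] apos by (auto simp: m_def n_def \<alpha>_def)
  have ev_pos: "\<forall>\<^sub>F \<nu> in at_right 0. (\<nu>::real) > 0"
    by (rule eventually_at_right_less)
  have w: "w \<nu> \<ge> 0" and log: "2 * m \<nu> * \<Xi> \<nu> = L \<nu> + D \<nu>" if "\<nu> > 0" for \<nu>
  proof -
    have w_eq: "n \<nu> / m \<nu> + \<eta> / (2 * \<kappa> * \<alpha> \<nu>) * (1 - F \<nu>) + (\<eta> * n \<nu> / \<alpha> \<nu> + \<eta> * F \<nu>) / (2 * \<kappa> * m \<nu>) = w \<nu>"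
      by (simp add: w_def)
    note E = interface_equation_log[OF mn[OF that] pos(4,1) F_def[of \<nu>] less_imp_le[OF \<Xi>_pos[OF that]]
        eq[OF that, folded m_def n_def \<alpha>_def, folded F_def], unfolded w_eq]
    show "w \<nu> \<ge> 0" by (rule E)
    have G: "G \<nu> \<ge> 1" "char_root (S\<^sup>2 * \<nu>\<^sup>2) \<ge> 1"
      by (auto simp: G_def intro!: char_root_ge_1)
    have "A \<nu> > 0"
      unfolding A_def using G apos by (intro divide_pos_pos mult_pos_pos add_pos_nonneg) auto
    have "2 * \<kappa> * m \<nu> / (\<eta> * (1 + n \<nu> / \<alpha> \<nu>)) = 2 * (1 - \<kappa>)\<^sup>2 / (\<nu>\<^sup>2 * S * \<eta>) * A \<nu>"
    proof -
      have "n \<nu> / \<alpha> \<nu> = char_root (S\<^sup>2 * \<nu>\<^sup>2) / (a * G \<nu>)"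
        using pos by (simp add: n_def \<alpha>_def slow_rate_def G_def)
      moreover have "2 * \<kappa> * m \<nu> / \<eta> = 2 * (1 - \<kappa>)\<^sup>2 / (\<nu>\<^sup>2 * S * \<eta>) * (G \<nu> * (1 + 1 / a))"
        using pos that unfolding m_def fast_rate_def G_def[symmetric]
        by (simp add: a field_simps power2_eq_square)
      ultimately show ?thesis
        unfolding A_def by (metis divide_divide_eq_left times_divide_eq_right)
    qed
    moreover have "2 * (1 - \<kappa>)\<^sup>2 / (\<nu>\<^sup>2 * S * \<eta>) > 0"
      using pos that by simp
    ultimately have "ln (2 * \<kappa> * m \<nu> / (\<eta> * (1 + n \<nu> / \<alpha> \<nu>))) = L \<nu> + ln (A \<nu>)"
      using \<open>A \<nu> > 0\<close> unfolding L_def by (metis ln_mult_pos)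
    then show "2 * m \<nu> * \<Xi> \<nu> = L \<nu> + D \<nu>"
      using E(2) by (simp only: D_def add.assoc)
  qed
  have L_top: "filterlim L at_top (at_right 0)"
    unfolding L_def[abs_def] using pos by real_asymp
  have \<nu>L: "((\<lambda>\<nu>. \<nu>\<^sup>2 * L \<nu>) \<longlongrightarrow> 0) (at_right 0)"
    unfolding L_def[abs_def] using pos by real_asymp
  have one_L: "(\<lambda>_. 1) \<in> O[at_right 0](L)"
    unfolding L_def[abs_def] using pos by real_asymp
  have two_L: "(\<lambda>\<nu>. \<nu>\<^sup>2) \<in> O[at_right 0](\<lambda>\<nu>. \<nu>\<^sup>2 * L \<nu>)"
    using landau_o.big.mult[OF landau_o.big_refl one_L, of "\<lambda>\<nu>. \<nu>\<^sup>2"] by simp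
  have n_bounded: "n \<in> O[at_right 0](\<lambda>_. 1)"
    using slow_rate_tendsto[OF apos, of S] unfolding n_def by (intro bigoI_tendsto) auto
  have \<alpha>_bounded: "(\<lambda>\<nu>. 1 / \<alpha> \<nu>) \<in> O[at_right 0](\<lambda>_. 1)"
  proof (rule bigoI_tendsto)
    show "((\<lambda>\<nu>. 1 / \<alpha> \<nu> / 1) \<longlongrightarrow> 1 / (S / 1) / 1) (at_right 0)"
      unfolding \<alpha>_def by (intro tendsto_intros slow_rate_tendsto) (use pos in auto)
  qed simp
  have m_bigo: "(\<lambda>\<nu>. 1 / m \<nu>) \<in> O[at_right 0](\<lambda>\<nu>. \<nu>\<^sup>2)"
  proof (rule bigoI_tendsto)
    have "((\<lambda>\<nu>. 1 / (\<nu>\<^sup>2 * m \<nu>)) \<longlongrightarrow> 1 / (a / S)) (at_right 0)"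
      unfolding m_def by (intro tendsto_intros fast_rate_tendsto) (use pos apos in auto)
    then show "((\<lambda>\<nu>. 1 / m \<nu> / \<nu>\<^sup>2) \<longlongrightarrow> 1 / (a / S)) (at_right 0)"
      by (simp add: mult.commute)
    show "\<forall>\<^sub>F \<nu> in at_right 0. (\<nu>::real)\<^sup>2 \<noteq> 0"
      using ev_pos by eventually_elim simp
  qed
  have sq_bounded: "(\<lambda>\<nu>::real. \<nu>\<^sup>2) \<in> O[at_right 0](\<lambda>_. 1)"
    by real_asymp
  have F01: "0 \<le> 1 - F \<nu> \<and> F \<nu> \<le> 1 \<and> 0 \<le> F \<nu> \<and> 1 - F \<nu> \<le> 2 * n \<nu> * \<Xi> \<nu>" if "\<nu> > 0" for \<nu>
    using mn[OF that] \<Xi>_pos[OF that] exp_ge_add_one_self[of "- (2 * n \<nu> * \<Xi> \<nu>)"]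
    by (auto simp: F_def)
  have F_bounded: "F \<in> O[at_right 0](\<lambda>_. 1)"
    by (rule bigoI[of _ 1], use ev_pos in eventually_elim) (use F01 in auto)
  have bounded_mult: "(\<lambda>\<nu>. f \<nu> * h \<nu>) \<in> O[at_right 0](g)"
    if "f \<in> O[at_right 0](\<lambda>_. 1)" "h \<in> O[at_right 0](g)" for f h g :: "real \<Rightarrow> real"
    using landau_o.big.mult[OF that] by (simp only: mult_1)
  have bounded_cmult: "(\<lambda>\<nu>. c * f \<nu>) \<in> O[at_right 0](\<lambda>_. 1)"
    if "f \<in> O[at_right 0](\<lambda>_. 1)" for c :: real and f :: "real \<Rightarrow> real"
    by (rule bounded_mult[OF bigo_const that])
  have w_bigo: "w \<in> O[at_right 0](g)"
    if "(\<lambda>\<nu>. 1 - F \<nu>) \<in> O[at_right 0](g)" "(\<lambda>\<nu>. \<nu>\<^sup>2) \<in> O[at_right 0](g)" for g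
  proof -
    have m_g: "(\<lambda>\<nu>. 1 / m \<nu>) \<in> O[at_right 0](g)"
      using m_bigo that(2) by (rule landau_o.big_trans)
    have mid: "(\<lambda>\<nu>. \<eta> / (2 * \<kappa>) * (1 / \<alpha> \<nu>)) \<in> O[at_right 0](\<lambda>_. 1)"
      by (intro bounded_cmult \<alpha>_bounded)
    have last: "(\<lambda>\<nu>. 1 / (2 * \<kappa>) * (\<eta> * (n \<nu> * (1 / \<alpha> \<nu>)) + \<eta> * F \<nu>)) \<in> O[at_right 0](\<lambda>_. 1)"
      by (intro bounded_cmult sum_in_bigo bounded_mult n_bounded \<alpha>_bounded F_bounded)
    show ?thesis
      unfolding w_def[abs_def]
      by (rule sum_in_bigo(1)[OF sum_in_bigo(1)[OF
        bounded_mult[OF n_bounded m_g] bounded_mult[OF mid that(1)]] bounded_mult[OF last m_g]])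
  qed
  have D_bigo: "D \<in> O[at_right 0](g)"
    if "w \<in> O[at_right 0](g)" "(\<lambda>\<nu>. \<nu>\<^sup>2) \<in> O[at_right 0](g)" for g
    unfolding D_def[abs_def]
  proof (rule sum_in_bigo)
    have "(\<lambda>\<nu>. ln (A \<nu>)) \<in> O[at_right 0](\<lambda>\<nu>. \<nu>\<^sup>2)"
    proof (rule bigoI[of _ "S\<^sup>2 + 2 * (S / a)\<^sup>2"], rule always_eventually, rule allI)
      fix \<nu> :: real
      show "norm (ln (A \<nu>)) \<le> (S\<^sup>2 + 2 * (S / a)\<^sup>2) * norm (\<nu>\<^sup>2)"
        using abs_ln_amplitude_ratio_le[OF apos, of "S\<^sup>2 * \<nu>\<^sup>2" "(S / a)\<^sup>2 * \<nu>\<^sup>2"]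
        by (simp add: A_def G_def distrib_right)
    qed
    then show "(\<lambda>\<nu>. ln (A \<nu>)) \<in> O[at_right 0](g)"
      using that(2) by (rule landau_o.big_trans)
    have "(\<lambda>\<nu>. ln (1 + w \<nu>)) \<in> O[at_right 0](w)"
    proof (rule bigoI[of _ 1], use ev_pos in eventually_elim)
      fix \<nu> :: real assume "\<nu> > 0"
      from w[OF this] show "norm (ln (1 + w \<nu>)) \<le> 1 * norm (w \<nu>)"
        using ln_add_one_self_le_self[of "w \<nu>"] by simp
    qed
    then show "(\<lambda>\<nu>. ln (1 + w \<nu>)) \<in> O[at_right 0](g)"
      using that(1) by (rule landau_o.big_trans)
  qed
  (* First pass of the bootstrap: only the boundedness of F is used. *)
  have "(\<lambda>\<nu>. 1 - F \<nu>) \<in> O[at_right 0](\<lambda>_. 1)"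
    using F_bounded by (intro sum_in_bigo) simp_all
  then have "D \<in> O[at_right 0](\<lambda>_. 1)"
    by (intro D_bigo w_bigo sq_bounded)
  then have "D \<in> O[at_right 0](L)"
    using one_L by (rule landau_o.big_trans)
  then have "(\<lambda>\<nu>. L \<nu> + D \<nu>) \<in> O[at_right 0](L)"
    by (intro sum_in_bigo) simp_all
  then have "(\<lambda>\<nu>. 1 / m \<nu> * (L \<nu> + D \<nu>)) \<in> O[at_right 0](\<lambda>\<nu>. \<nu>\<^sup>2 * L \<nu>)"
    by (intro landau_o.big.mult m_bigo)
  note half = bounded_mult[OF bigo_const[of "1 / 2"] this]
  have \<Xi>_eq: "\<forall>\<^sub>F \<nu> in at_right 0. \<Xi> \<nu> = 1 / 2 * (1 / m \<nu> * (L \<nu> + D \<nu>))"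
    using ev_pos by eventually_elim (use log mn in \<open>force simp: field_simps\<close>)
  have \<Xi>_bigo: "\<Xi> \<in> O[at_right 0](\<lambda>\<nu>. \<nu>\<^sup>2 * L \<nu>)"
    by (rule iffD2[OF landau_o.big.in_cong[OF \<Xi>_eq] half])
  have "(\<lambda>\<nu>. \<nu>\<^sup>2 * L \<nu>) \<in> o[at_right 0](\<lambda>_. 1)"
    using \<nu>L by (intro smalloI_tendsto) simp_all
  with \<Xi>_bigo have "\<Xi> \<in> o[at_right 0](\<lambda>_. 1)"
    by (rule landau_o.big_small_trans)
  then show "(\<Xi> \<longlongrightarrow> 0) (at_right 0)"
    using smalloD_tendsto by fastforce
  (* Second pass: the bound on \<Xi> improves the bound on 1 - F. *)
  have "(\<lambda>\<nu>. 1 - F \<nu>) \<in> O[at_right 0](\<lambda>\<nu>. n \<nu> * \<Xi> \<nu>)"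
  proof (rule bigoI[of _ 2], use ev_pos in eventually_elim)
    fix \<nu> :: real assume "\<nu> > 0"
    with F01[of \<nu>] mn[of \<nu>] \<Xi>_pos[of \<nu>] show "norm (1 - F \<nu>) \<le> 2 * norm (n \<nu> * \<Xi> \<nu>)"
      by (simp add: abs_mult)
  qed
  also have "(\<lambda>\<nu>. n \<nu> * \<Xi> \<nu>) \<in> O[at_right 0](\<lambda>\<nu>. \<nu>\<^sup>2 * L \<nu>)"
    by (rule bounded_mult[OF n_bounded \<Xi>_bigo])
  finally have D: "D \<in> O[at_right 0](\<lambda>\<nu>. \<nu>\<^sup>2 * L \<nu>)"
    by (intro D_bigo w_bigo two_L)
  have L_pos: "\<forall>\<^sub>F \<nu> in at_right 0. L \<nu> > 0"
    using L_top by (simp add: filterlim_at_top_dense)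
  have "(\<lambda>\<nu>. D \<nu> / L \<nu>) \<in> O[at_right 0](\<lambda>\<nu>. \<nu>\<^sup>2 * L \<nu> / L \<nu>)"
    using D L_pos by (intro landau_o.big.divide_right) (auto elim: eventually_mono)
  also have "\<dots> = O[at_right 0](\<lambda>\<nu>. \<nu>\<^sup>2)"
    by (rule landau_o.big.cong) (use L_pos in eventually_elim, simp)
  finally have DL: "(\<lambda>\<nu>. D \<nu> / L \<nu>) \<in> O[at_right 0](\<lambda>\<nu>. \<nu>\<^sup>2)" .
  define r where "r \<nu> = (1 / G \<nu> - 1) + D \<nu> / L \<nu> * (1 / G \<nu>)" for \<nu>
  have "(\<lambda>\<nu>. 1 / G \<nu>) \<in> O[at_right 0](\<lambda>_. 1)"
  proof (rule bigoI[of _ 1], rule always_eventually, rule allI)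
    fix \<nu>
    have "G \<nu> \<ge> 1" by (auto simp: G_def intro!: char_root_ge_1)
    then show "norm (1 / G \<nu>) \<le> 1 * norm (1::real)" by simp
  qed
  from landau_o.big.mult[OF DL this] have "(\<lambda>\<nu>. D \<nu> / L \<nu> * (1 / G \<nu>)) \<in> O[at_right 0](\<lambda>\<nu>. \<nu>\<^sup>2)"
    by (simp only: mult_1_right)
  then have "r \<in> O[at_right 0](\<lambda>\<nu>. \<nu>\<^sup>2)"
    unfolding r_def[abs_def] G_def
    by (rule sum_in_bigo(1)[OF inverse_char_root_bigo])
  moreover have "\<forall>\<^sub>F \<nu> in at_right 0. \<Xi> \<nu> = \<nu>\<^sup>2 * S * \<kappa> / (2 * (1 - \<kappa>)) * L \<nu> * (1 + r \<nu>)"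
    using ev_pos L_pos
  proof eventually_elim
    fix \<nu> :: real assume \<nu>: "\<nu> > 0" "L \<nu> > 0"
    have G: "G \<nu> \<ge> 1" by (auto simp: G_def intro!: char_root_ge_1)
    have "m \<nu> = a * G \<nu> / (\<nu>\<^sup>2 * S)" by (simp add: m_def fast_rate_def G_def)
    moreover have "\<Xi> \<nu> = (L \<nu> + D \<nu>) / (2 * m \<nu>)"
      using log[OF \<nu>(1)] mn(1)[OF \<nu>(1)] by (simp add: field_simps)
    ultimately have "\<Xi> \<nu> = \<nu>\<^sup>2 * S / (2 * a) * ((L \<nu> + D \<nu>) / G \<nu>)"
      by (simp add: mult_ac)
    also have "(L \<nu> + D \<nu>) / G \<nu> = L \<nu> * (1 + r \<nu>)"
      using \<nu> G by (simp add: r_def field_simps)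
    finally show "\<Xi> \<nu> = \<nu>\<^sup>2 * S * \<kappa> / (2 * (1 - \<kappa>)) * L \<nu> * (1 + r \<nu>)"
      using pos by (simp add: a)
  qed
  ultimately show "\<exists>r. r \<in> O[at_right 0](\<lambda>\<nu>. \<nu>\<^sup>2) \<and> (\<forall>\<^sub>F \<nu> in at_right 0.
       \<Xi> \<nu> = \<nu>\<^sup>2 * S * \<kappa> / (2 * (1 - \<kappa>)) * ln (2 * (1 - \<kappa>)\<^sup>2 / (\<nu>\<^sup>2 * S * \<eta>)) * (1 + r \<nu>))"
    unfolding L_def by blast
qed

section \<open>Convergence of the profiles\<close>

theorem theorem4:
  fixes \<kappa> S \<eta> :: real
    and \<Xi> :: "real \<Rightarrow> real"
    and V U :: "real \<Rightarrow> real \<Rightarrow> real"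
  assumes "0 < \<kappa>" "\<kappa> < 1" "S > 0" "\<eta> > 0"
    and wave: "\<And>\<nu>. \<nu> > 0 \<Longrightarrow> relevant_traveling_wave \<nu> \<kappa> S \<eta> (\<Xi> \<nu>) (V \<nu>)"
    and profile: "\<And>\<nu>. \<nu> > 0 \<Longrightarrow> wave_profile \<kappa> (\<Xi> \<nu>) (V \<nu>) (U \<nu>)"
  shows "(\<exists>r. r \<in> O[at_right 0](\<lambda>\<nu>. \<nu>\<^sup>2) \<and>
            (\<forall>\<^sub>F \<nu> in at_right 0.
               \<Xi> \<nu> = \<nu>\<^sup>2 * S * \<kappa> / (2 * (1 - \<kappa>)) *
                      ln (2 * (1 - \<kappa>)\<^sup>2 / (\<nu>\<^sup>2 * S * \<eta>)) * (1 + r \<nu>)))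
       \<and> (\<Xi> \<longlongrightarrow> 0) (at_right 0)
       \<and> (\<forall>X<0. ((\<lambda>\<nu>. U \<nu> X) \<longlongrightarrow> -\<kappa> - \<eta> / S * (1 - exp (S * X))) (at_right 0))
       \<and> (\<forall>X>0. ((\<lambda>\<nu>. U \<nu> X) \<longlongrightarrow> 2 - \<kappa> + (\<eta> + 2 * S) / S * (exp (S * X) - 1)) (at_right 0))"
proof -
  note pos = assms(1-4)
  define a where "a = (1 - \<kappa>) / \<kappa>"
  define m where "m = fast_rate S a"
  define n where "n = slow_rate S a"
  define \<alpha> where "\<alpha> = slow_rate S 1"
  define p where "p = fast_rate S 1"
  define Z where "Z \<nu> = 2 * \<kappa> + \<eta> / \<alpha> \<nu>" for \<nu>
  define F where "F \<nu> = exp (- (2 * n \<nu> * \<Xi> \<nu>))" for \<nu>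
  define v where "v \<nu> = m \<nu> * Z \<nu> + \<eta> * (1 - m \<nu> / \<alpha> \<nu>) * F \<nu>" for \<nu>
  have apos: "a > 0" using pos by (simp add: a_def)
  have \<alpha>: "\<alpha> \<nu> = lambda_plus \<nu> S" "\<alpha> \<nu> > 0" "\<alpha> \<nu> * p \<nu> = 1 / \<nu>\<^sup>2" "\<alpha> \<nu> - p \<nu> = - 1 / (\<nu>\<^sup>2 * S)"
    and p: "p \<nu> > 0" if "\<nu> > 0" for \<nu>
    using rates_pos[OF pos(3) _ that, of 1] rates_vieta(1)[OF that pos(3), of 1]
      rates_vieta(2)[OF that pos(3), of 1] lambda_plus_eq_slow_rate[OF that pos(3)]
    by (simp_all add: \<alpha>_def p_def)
  have mn: "m \<nu> * n \<nu> = 1 / \<nu>\<^sup>2" "m \<nu> - n \<nu> = (1 - \<kappa>) / (\<nu>\<^sup>2 * S * \<kappa>)" if "\<nu> > 0" for \<nu>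
  proof -
    show "m \<nu> * n \<nu> = 1 / \<nu>\<^sup>2"
      using rates_vieta(1)[OF that pos(3) apos] by (simp add: m_def n_def mult.commute)
    have "m \<nu> - n \<nu> = a / (\<nu>\<^sup>2 * S)"
      using rates_vieta(2)[OF that pos(3) apos] by (simp add: m_def n_def)
    then show "m \<nu> - n \<nu> = (1 - \<kappa>) / (\<nu>\<^sup>2 * S * \<kappa>)"
      by (simp add: a_def mult.commute)
  qed
  have \<Xi>_pos: "\<Xi> \<nu> > 0" if "\<nu> > 0" for \<nu>
    using wave[OF that] by (simp add: relevant_traveling_wave_def)
  note explicit = relevant_wave_explicit[OF wave profile \<alpha>(1,2) _ pos(3,1) \<alpha>(3,4) mn]
  have eq: "(m \<nu> + n \<nu>) * (2 * \<kappa> + \<eta> / \<alpha> \<nu>) = \<eta> * (1 + n \<nu> / \<alpha> \<nu>) * exp (2 * m \<nu> * \<Xi> \<nu>)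
      + \<eta> * (m \<nu> / \<alpha> \<nu> - 1) * exp (- (2 * n \<nu> * \<Xi> \<nu>))" if "\<nu> > 0" for \<nu>
    using that by (intro explicit) 
  note width = interface_width_asymptotics[OF pos a_def \<Xi>_pos eq[unfolded m_def n_def \<alpha>_def]]
  have ev_pos: "\<forall>\<^sub>F \<nu> in at_right 0. (\<nu>::real) > 0"
    by (rule eventually_at_right_less)
  have \<alpha>_lim: "(\<alpha> \<longlongrightarrow> S) (at_right 0)"
    using slow_rate_tendsto[of 1 S] by (simp add: \<alpha>_def)
  have n_lim: "(n \<longlongrightarrow> S / a) (at_right 0)"
    unfolding n_def by (rule slow_rate_tendsto[OF apos])
  have m_lim: "((\<lambda>\<nu>. \<nu>\<^sup>2 * m \<nu>) \<longlongrightarrow> a / S) (at_right 0)"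
    unfolding m_def by (rule fast_rate_tendsto[OF pos(3)])
  have p_lim: "((\<lambda>\<nu>. \<nu>\<^sup>2 * p \<nu>) \<longlongrightarrow> 1 / S) (at_right 0)"
    unfolding p_def by (rule fast_rate_tendsto[OF pos(3)])
  have sq_lim: "((\<lambda>\<nu>::real. \<nu>\<^sup>2) \<longlongrightarrow> 0) (at_right 0)"
    by real_asymp
  have \<Xi>_lim: "(\<Xi> \<longlongrightarrow> 0) (at_right 0)"
    by (rule width(1))
  have left: "((\<lambda>\<nu>. U \<nu> X) \<longlongrightarrow> -\<kappa> - \<eta> / S * (1 - exp (S * X))) (at_right 0)" if "X < 0" for X
  proof (rule Lim_transform_eventually)
    show "((\<lambda>\<nu>. -\<kappa> - \<eta> / \<alpha> \<nu> * (1 - exp (\<alpha> \<nu> * (X + \<Xi> \<nu>)))) \<longlongrightarrow>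
        -\<kappa> - \<eta> / S * (1 - exp (S * X))) (at_right 0)"
      by (rule tendsto_eq_intros \<alpha>_lim \<Xi>_lim refl | use pos in simp)+
    have "\<forall>\<^sub>F \<nu> in at_right 0. \<Xi> \<nu> < - X"
      using \<Xi>_lim that by (intro order_tendstoD) auto
    with ev_pos show "\<forall>\<^sub>F \<nu> in at_right 0. -\<kappa> - \<eta> / \<alpha> \<nu> * (1 - exp (\<alpha> \<nu> * (X + \<Xi> \<nu>))) = U \<nu> X"
      by eventually_elim (rule relevant_wave_left[OF wave profile \<alpha>(1,2), symmetric], auto)
  qed
  have right: "((\<lambda>\<nu>. U \<nu> X) \<longlongrightarrow> 2 - \<kappa> + (\<eta> + 2 * S) / S * (exp (S * X) - 1)) (at_right 0)" if "X > 0" for X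
  proof (rule Lim_transform_eventually)
    have F_lim: "(F \<longlongrightarrow> 1) (at_right 0)"
      unfolding F_def[abs_def] by (rule tendsto_eq_intros n_lim \<Xi>_lim refl | simp)+
    have Z_lim: "(Z \<longlongrightarrow> 2 * \<kappa> + \<eta> / S) (at_right 0)"
      unfolding Z_def[abs_def] by (intro tendsto_intros \<alpha>_lim) (use pos in auto)
    (* V(\<Xi>) grows like 1/\<nu>^2. Its limit after scaling yields the jump of U by 2(1-\<kappa>) in the boundary layer
       to the right of the interface; the contributions of \<eta> cancel. *)
    have v_lim: "((\<lambda>\<nu>. \<nu>\<^sup>2 * v \<nu>) \<longlongrightarrow> 2 * \<kappa> * a / S) (at_right 0)"
    proof -
      have "((\<lambda>\<nu>. (\<nu>\<^sup>2 * m \<nu>) * Z \<nu> + \<eta> * (\<nu>\<^sup>2 - (\<nu>\<^sup>2 * m \<nu>) / \<alpha> \<nu>) * F \<nu>) \<longlongrightarrow>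
          (a / S) * (2 * \<kappa> + \<eta> / S) + \<eta> * (0 - (a / S) / S) * 1) (at_right 0)"
        by (intro tendsto_intros \<alpha>_lim m_lim Z_lim F_lim sq_lim) (use pos in auto)
      moreover have "(a / S) * (2 * \<kappa> + \<eta> / S) + \<eta> * (0 - (a / S) / S) * 1 = 2 * \<kappa> * a / S"
        by (simp add: algebra_simps add_divide_distrib)
      moreover have "(\<lambda>\<nu>. (\<nu>\<^sup>2 * m \<nu>) * Z \<nu> + \<eta> * (\<nu>\<^sup>2 - (\<nu>\<^sup>2 * m \<nu>) / \<alpha> \<nu>) * F \<nu>) = (\<lambda>\<nu>. \<nu>\<^sup>2 * v \<nu>)"
        by (auto simp: v_def algebra_simps)
      ultimately show ?thesis by simp
    qed
    have decay: "((\<lambda>\<nu>. exp (- (p \<nu> * (X - \<Xi> \<nu>)))) \<longlongrightarrow> 0) (at_right 0)"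
    proof -
      have "filterlim (\<lambda>\<nu>::real. inverse (\<nu>\<^sup>2)) at_top (at_right 0)"
        by real_asymp
      then have "filterlim (\<lambda>\<nu>. (\<nu>\<^sup>2 * p \<nu>) * (X - \<Xi> \<nu>) * inverse (\<nu>\<^sup>2)) at_top (at_right 0)"
        by (rule filterlim_tendsto_pos_mult_at_top[rotated -1])
          (rule tendsto_mult[OF p_lim tendsto_diff[OF tendsto_const \<Xi>_lim]], use that pos in simp)
      moreover have "\<forall>\<^sub>F \<nu> in at_right 0. (\<nu>\<^sup>2 * p \<nu>) * (X - \<Xi> \<nu>) * inverse (\<nu>\<^sup>2) = p \<nu> * (X - \<Xi> \<nu>)"
        using ev_pos by eventually_elim simp
      ultimately have "filterlim (\<lambda>\<nu>. p \<nu> * (X - \<Xi> \<nu>)) at_top (at_right 0)"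
        using filterlim_cong[OF refl refl] by fast
      then have "filterlim (\<lambda>\<nu>. - (p \<nu> * (X - \<Xi> \<nu>))) at_bot (at_right 0)"
        by (simp add: filterlim_uminus_at_bot)
      then show ?thesis
        by (rule filterlim_compose[OF exp_at_bot])
    qed
    (* Numerator and denominator of the explicit solution are scaled by \<nu>^2, the inverse order of v and p. *)
    have "((\<lambda>\<nu>. ((\<nu>\<^sup>2 * v \<nu> + \<nu>\<^sup>2 * p \<nu> * Z \<nu>) * exp (\<alpha> \<nu> * (X - \<Xi> \<nu>))
        - (\<nu>\<^sup>2 * v \<nu> - \<nu>\<^sup>2 * \<alpha> \<nu> * Z \<nu>) * exp (- (p \<nu> * (X - \<Xi> \<nu>))))
        / (\<nu>\<^sup>2 * \<alpha> \<nu> + \<nu>\<^sup>2 * p \<nu>) - \<kappa> - \<eta> / \<alpha> \<nu>) \<longlongrightarrow>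
      ((2 * \<kappa> * a / S + 1 / S * (2 * \<kappa> + \<eta> / S)) * exp (S * (X - 0))
        - (2 * \<kappa> * a / S - 0 * S * (2 * \<kappa> + \<eta> / S)) * 0) / (0 * S + 1 / S) - \<kappa> - \<eta> / S) (at_right 0)"
      by (intro tendsto_intros v_lim p_lim Z_lim \<alpha>_lim \<Xi>_lim sq_lim decay) (use pos in auto)
    also have "((2 * \<kappa> * a / S + 1 / S * (2 * \<kappa> + \<eta> / S)) * exp (S * (X - 0))
        - (2 * \<kappa> * a / S - 0 * S * (2 * \<kappa> + \<eta> / S)) * 0) / (0 * S + 1 / S) - \<kappa> - \<eta> / S
        = 2 - \<kappa> + (\<eta> + 2 * S) / S * (exp (S * X) - 1)"
      using pos by (simp add: a_def field_simps)
    finally show "((\<lambda>\<nu>. ((\<nu>\<^sup>2 * v \<nu> + \<nu>\<^sup>2 * p \<nu> * Z \<nu>) * exp (\<alpha> \<nu> * (X - \<Xi> \<nu>))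
        - (\<nu>\<^sup>2 * v \<nu> - \<nu>\<^sup>2 * \<alpha> \<nu> * Z \<nu>) * exp (- (p \<nu> * (X - \<Xi> \<nu>))))
        / (\<nu>\<^sup>2 * \<alpha> \<nu> + \<nu>\<^sup>2 * p \<nu>) - \<kappa> - \<eta> / \<alpha> \<nu>) \<longlongrightarrow>
        2 - \<kappa> + (\<eta> + 2 * S) / S * (exp (S * X) - 1)) (at_right 0)" .
    have "\<forall>\<^sub>F \<nu> in at_right 0. \<Xi> \<nu> < X"
      using \<Xi>_lim that by (intro order_tendstoD) auto
    with ev_pos show "\<forall>\<^sub>F \<nu> in at_right 0. ((\<nu>\<^sup>2 * v \<nu> + \<nu>\<^sup>2 * p \<nu> * Z \<nu>) * exp (\<alpha> \<nu> * (X - \<Xi> \<nu>))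
        - (\<nu>\<^sup>2 * v \<nu> - \<nu>\<^sup>2 * \<alpha> \<nu> * Z \<nu>) * exp (- (p \<nu> * (X - \<Xi> \<nu>))))
        / (\<nu>\<^sup>2 * \<alpha> \<nu> + \<nu>\<^sup>2 * p \<nu>) - \<kappa> - \<eta> / \<alpha> \<nu> = U \<nu> X"
    proof eventually_elim
      fix \<nu> :: real assume \<nu>: "\<nu> > 0" "\<Xi> \<nu> < X"
      have "(\<alpha> \<nu> + p \<nu>) * (U \<nu> X + \<kappa> + \<eta> / \<alpha> \<nu>) =
        (v \<nu> + p \<nu> * Z \<nu>) * exp (\<alpha> \<nu> * (X - \<Xi> \<nu>)) - (v \<nu> - \<alpha> \<nu> * Z \<nu>) * exp (- (p \<nu> * (X - \<Xi> \<nu>)))"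
        using explicit(2)[of \<nu> X] \<nu> unfolding v_def Z_def F_def by auto
      then have "(\<nu>\<^sup>2 * \<alpha> \<nu> + \<nu>\<^sup>2 * p \<nu>) * (U \<nu> X + \<kappa> + \<eta> / \<alpha> \<nu>) =
        (\<nu>\<^sup>2 * v \<nu> + \<nu>\<^sup>2 * p \<nu> * Z \<nu>) * exp (\<alpha> \<nu> * (X - \<Xi> \<nu>))
        - (\<nu>\<^sup>2 * v \<nu> - \<nu>\<^sup>2 * \<alpha> \<nu> * Z \<nu>) * exp (- (p \<nu> * (X - \<Xi> \<nu>)))"
        by (simp only: mult.assoc distrib_left[symmetric] right_diff_distrib[symmetric])
      moreover have "\<nu>\<^sup>2 * \<alpha> \<nu> + \<nu>\<^sup>2 * p \<nu> > 0"
        using \<alpha>(2)[OF \<nu>(1)] p[OF \<nu>(1)] \<nu> by (simp add: add_pos_pos)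
      ultimately show "((\<nu>\<^sup>2 * v \<nu> + \<nu>\<^sup>2 * p \<nu> * Z \<nu>) * exp (\<alpha> \<nu> * (X - \<Xi> \<nu>))
        - (\<nu>\<^sup>2 * v \<nu> - \<nu>\<^sup>2 * \<alpha> \<nu> * Z \<nu>) * exp (- (p \<nu> * (X - \<Xi> \<nu>))))
        / (\<nu>\<^sup>2 * \<alpha> \<nu> + \<nu>\<^sup>2 * p \<nu>) - \<kappa> - \<eta> / \<alpha> \<nu> = U \<nu> X"
        by (simp only: flip: \<open>(\<nu>\<^sup>2 * \<alpha> \<nu> + \<nu>\<^sup>2 * p \<nu>) * _ = _\<close>) simp
    qed
  qed
  show ?thesis
    using width \<Xi>_lim left right by blast
qed

end
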